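(* Let $0\le m\le n$. There is a quantum algorithm that, given oracle access to two functions $f,g:\{0,1\}^n\to\{1,-1\}$, verifies whether $f$ and $g$ are uncorrelated of degree $m$ with constant probability by making $\mathcal{O}\left(\frac1a\right)$ queries to $f$ and to $g$ each, where $a\ge0$ is given by $$a^2=\frac{1}{2^{3n}}\sum_{\mathbf{x}:\,wt(\mathbf{x})\le m}C_{f,g}(\mathbf{x})^2 .$$
   Context: For $\mathbf{x}\in\{0,1\}^n$, $wt(\mathbf{x})$ is the number of $1$'s in $\mathbf{x}$. The cross-correlation of $f,g$ at $\mathbf{y}\in\{0,1\}^n$ is $C_{f,g}(\mathbf{y})=\sum_{\mathbf{x}\in\{0,1\}^n}f(\mathbf{x})g(\mathbf{x}\oplus\mathbf{y})$. Functions $f$ and $g$ are uncorrelated of degree $m$ if $C_{f,g}(\mathbf{y})=0$ for all $\mathbf{y}$ with $0\le wt(\mathbf{y})\le m$. Quantum query (black-box) model: a query to $h:\{0,1\}^n\to\{1,-1\}$ is one application of $U_h|\mathbf{x}\rangle|a\rangle=|\mathbf{x}\rangle\left|a\oplus\frac{1-h(\mathbf{x})}{2}\right\rangle$ (possibly controlled, or inverted); other operations do not depend on $f,g$. Meaning of "verifies with constant probability by making $\mathcal{O}(B)$ queries", where $B=B(f,g)\in[0,\infty]$ (with the convention $1/0=+\infty$): there are absolute constants $c>0$ and $K$ such that, if $f$ and $g$ are uncorrelated of degree $m$, the algorithm never reports that they are not; and if they are not uncorrelated of degree $m$, then with probability at least $c$ the algorithm reports this (by finding a point $\mathbf{u}$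 with $wt(\mathbf{u})\le m$ and $C_{f,g}(\mathbf{u})\ne0$) after at most $K\cdot B$ queries to each of $f$ and $g$. *)

theory Defs
  imports "HOL-Analysis.Analysis"
begin

section \<open>Boolean functions and cross-correlation\<close>

definition cube :: "nat \<Rightarrow> bool list set" where
  "cube n = {x. length x = n}"

definition wt :: "bool list \<Rightarrow> nat" where
  "wt x = count_list x True"

definition xor_list :: "bool list \<Rightarrow> bool list \<Rightarrow> bool list" where
  "xor_list x y = map2 (\<noteq>) x y"

definition cross_corr ::
  "nat \<Rightarrow> (bool list \<Rightarrow> int) \<Rightarrow> (bool list \<Rightarrow> int) \<Rightarrow> bool list \<Rightarrow> int" where
  "cross_corr n f g y = (\<Sum>x\<in>cube n. f x * g (xor_list x y))"

definition uncorrelated ::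
  "nat \<Rightarrow> nat \<Rightarrow> (bool list \<Rightarrow> int) \<Rightarrow> (bool list \<Rightarrow> int) \<Rightarrow> bool" where
  "uncorrelated n m f g \<longleftrightarrow> (\<forall>y\<in>cube n. wt y \<le> m \<longrightarrow> cross_corr n f g y = 0)"

definition corr_amp ::
  "nat \<Rightarrow> nat \<Rightarrow> (bool list \<Rightarrow> int) \<Rightarrow> (bool list \<Rightarrow> int) \<Rightarrow> real" where
  "corr_amp n m f g =
     sqrt (1 / 2 ^ (3 * n) *
       (\<Sum>x\<in>{x\<in>cube n. wt x \<le> m}. (real_of_int (cross_corr n f g x))\<^sup>2))"

section \<open>States and operators\<close>

text \<open>
  A label \<open>(x, a, w)\<close> stands for the computational basis vector \<open>|x>|a>|w>\<close>: the input register
  and the target qubit of the oracles, followed by a workspace of \<open>s\<close> qubits.  States are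
  coefficient functions on labels, of which only the values on \<^term>\<open>labels n s\<close> matter.
\<close>

type_synonym label = "bool list \<times> bool \<times> bool list"
type_synonym qstate = "label \<Rightarrow> complex"

text \<open>\<open>U b c\<close> is the matrix entry in row \<open>b\<close> and column \<open>c\<close>.\<close>

type_synonym qop = "label \<Rightarrow> label \<Rightarrow> complex"

definition labels :: "nat \<Rightarrow> nat \<Rightarrow> label set" where
  "labels n s = cube n \<times> UNIV \<times> cube s"

definition apply_op :: "nat \<Rightarrow> nat \<Rightarrow> qop \<Rightarrow> qstate \<Rightarrow> qstate" where
  "apply_op n s U \<psi> =
     (\<lambda>b. if b \<in> labels n s then \<Sum>c\<in>labels n s. U b c * \<psi> c else 0)"

definition unitary_op :: "nat \<Rightarrow> nat \<Rightarrow> qop \<Rightarrow> bool" where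
  "unitary_op n s U \<longleftrightarrow>
     (\<forall>b\<in>labels n s. \<forall>c\<in>labels n s.
        (\<Sum>d\<in>labels n s. cnj (U d b) * U d c) = of_bool (b = c) \<and>
        (\<Sum>d\<in>labels n s. U b d * cnj (U c d)) = of_bool (b = c))"

definition normsq :: "nat \<Rightarrow> nat \<Rightarrow> qstate \<Rightarrow> real" where
  "normsq n s \<psi> = (\<Sum>b\<in>labels n s. (cmod (\<psi> b))\<^sup>2)"

definition init_state :: "nat \<Rightarrow> nat \<Rightarrow> qstate" where
  "init_state n s = (\<lambda>b. of_bool (b = (replicate n False, False, replicate s False)))"

text \<open>
  The oracle \<open>|x>|a> \<mapsto> |x>|a XOR (1 - h x) / 2>\<close>; with control \<open>Some i\<close> it acts only if
  qubit \<open>i\<close> of the workspace is \<open>1\<close>.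
\<close>

definition oracle_map :: "(bool list \<Rightarrow> int) \<Rightarrow> nat option \<Rightarrow> label \<Rightarrow> label" where
  "oracle_map h ctrl = (\<lambda>(x, a, w).
     if (case ctrl of None \<Rightarrow> True | Some i \<Rightarrow> w ! i)
     then (x, a \<noteq> ((1 - h x) div 2 = 1), w) else (x, a, w))"

definition oracle_op :: "(bool list \<Rightarrow> int) \<Rightarrow> nat option \<Rightarrow> qop" where
  "oracle_op h ctrl = (\<lambda>b c. of_bool (b = oracle_map h ctrl c))"

section \<open>Query algorithms\<close>

text \<open>
  Measurements are projective measurements of a function \<open>L\<close> of the basis label; any other
  projective measurement is obtained by conjugating with a unitary.  The rest of the computation
  may depend on the outcome.  \<open>Halt (Some u)\<close> reports that the functions are correlated, with
  witness \<open>u\<close>; \<open>Halt None\<close> stops without such a report.  There is no separate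
  instruction for inverse queries: oracles are self-inverse, see \<open>oracle_op_self_inverse\<close>.
\<close>

datatype qalg =
    Halt "bool list option"
  | Apply qop qalg
  | Query_f "nat option" qalg
  | Query_g "nat option" qalg
  | Measure "label \<Rightarrow> bool list" "bool list \<Rightarrow> qalg"

primrec valid_qalg :: "nat \<Rightarrow> nat \<Rightarrow> qalg \<Rightarrow> bool" where
  "valid_qalg n s (Halt v) \<longleftrightarrow> True"
| "valid_qalg n s (Apply U A) \<longleftrightarrow> unitary_op n s U \<and> valid_qalg n s A"
| "valid_qalg n s (Query_f ctrl A) \<longleftrightarrow> (\<forall>i. ctrl = Some i \<longrightarrow> i < s) \<and> valid_qalg n s A"
| "valid_qalg n s (Query_g ctrl A) \<longleftrightarrow> (\<forall>i. ctrl = Some i \<longrightarrow> i < s) \<and> valid_qalg n s A"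
| "valid_qalg n s (Measure L A) \<longleftrightarrow> (\<forall>k. valid_qalg n s (A k))"

text \<open>
  \<open>run_prob n s f g A \<psi> E\<close> is the probability that \<open>A\<close>, started in \<open>\<psi>\<close>, halts with a verdict \<open>v\<close>
  after exactly \<open>p\<close> queries to \<open>f\<close> and \<open>q\<close> queries to \<open>g\<close> such that \<open>E v p q\<close> holds.  The
  projected states are not renormalized, so that the squared norm of the state accumulates the
  probability of the outcomes observed so far.
\<close>

primrec run_prob ::
  "nat \<Rightarrow> nat \<Rightarrow> (bool list \<Rightarrow> int) \<Rightarrow> (bool list \<Rightarrow> int) \<Rightarrow> qalg \<Rightarrow> qstate \<Rightarrow>
   (bool list option \<Rightarrow> nat \<Rightarrow> nat \<Rightarrow> bool) \<Rightarrow> real" where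
  "run_prob n s f g (Halt v) \<psi> E = (if E v 0 0 then normsq n s \<psi> else 0)"
| "run_prob n s f g (Apply U A) \<psi> E = run_prob n s f g A (apply_op n s U \<psi>) E"
| "run_prob n s f g (Query_f ctrl A) \<psi> E =
     run_prob n s f g A (apply_op n s (oracle_op f ctrl) \<psi>) (\<lambda>v p q. E v (Suc p) q)"
| "run_prob n s f g (Query_g ctrl A) \<psi> E =
     run_prob n s f g A (apply_op n s (oracle_op g ctrl) \<psi>) (\<lambda>v p q. E v p (Suc q))"
| "run_prob n s f g (Measure L A) \<psi> E =
     (\<Sum>k\<in>L ` labels n s. run_prob n s f g (A k) (\<lambda>b. if L b = k then \<psi> b else 0) E)"

abbreviation alg_prob ::
  "nat \<Rightarrow> nat \<Rightarrow> (bool list \<Rightarrow> int) \<Rightarrow> (bool list \<Rightarrow> int) \<Rightarrow> qalg \<Rightarrow>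
   (bool list option \<Rightarrow> nat \<Rightarrow> nat \<Rightarrow> bool) \<Rightarrow> real" where
  "alg_prob n s f g A E \<equiv> run_prob n s f g A (init_state n s) E"

section \<open>Well-definedness of the model\<close>

lemma finite_cube [simp]: "finite (cube n)"
  using finite_lists_length_eq[of "UNIV :: bool set" n] by (simp add: cube_def)

lemma finite_labels [simp]: "finite (labels n s)"
  by (simp add: labels_def)

lemma oracle_map_involution: "oracle_map h ctrl (oracle_map h ctrl b) = b"
  by (cases b) (auto simp: oracle_map_def split: option.splits)

lemma oracle_map_labels: "oracle_map h ctrl b \<in> labels n s \<longleftrightarrow> b \<in> labels n s"
  by (cases b) (auto simp: oracle_map_def labels_def split: option.splits)

lemma apply_oracle_op:
  "apply_op n s (oracle_op h ctrl) \<psi> =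
     (\<lambda>b. if b \<in> labels n s then \<psi> (oracle_map h ctrl b) else 0)"
proof
  fix b
  have eq: "b = oracle_map h ctrl c \<longleftrightarrow> c = oracle_map h ctrl b" for c
    using oracle_map_involution by metis
  have "of_bool (c = oracle_map h ctrl b) * \<psi> c
      = (if c = oracle_map h ctrl b then \<psi> c else 0)" for c
    by simp
  then show "apply_op n s (oracle_op h ctrl) \<psi> b =
      (if b \<in> labels n s then \<psi> (oracle_map h ctrl b) else 0)"
    by (auto simp: apply_op_def oracle_op_def eq oracle_map_labels sum.delta')
qed

lemma oracle_op_self_inverse:
  assumes "b \<in> labels n s"
  shows "apply_op n s (oracle_op h ctrl) (apply_op n s (oracle_op h ctrl) \<psi>) b = \<psi> b"
  using assms by (simp add: apply_oracle_op oracle_map_labels oracle_map_involution)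

lemma normsq_oracle: "normsq n s (apply_op n s (oracle_op h ctrl) \<psi>) = normsq n s \<psi>"
  unfolding normsq_def
  by (rule sum.reindex_bij_witness[of _ "oracle_map h ctrl" "oracle_map h ctrl"])
     (auto simp: apply_oracle_op oracle_map_labels oracle_map_involution)

lemma normsq_unitary:
  assumes "unitary_op n s U"
  shows "normsq n s (apply_op n s U \<psi>) = normsq n s \<psi>"
proof -
  let ?L = "labels n s"
  have "complex_of_real (normsq n s (apply_op n s U \<psi>))
      = (\<Sum>d\<in>?L. (\<Sum>c\<in>?L. U d c * \<psi> c) * cnj (\<Sum>b\<in>?L. U d b * \<psi> b))"
    by (simp add: normsq_def apply_op_def complex_norm_square del: of_real_power cnj_sum)
  also have "\<dots> = (\<Sum>d\<in>?L. \<Sum>c\<in>?L. \<Sum>b\<in>?L. (cnj (U d b) * U d c) * (\<psi> c * cnj (\<psi> b)))"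
    by (simp add: sum_product algebra_simps)
  also have "\<dots> = (\<Sum>c\<in>?L. \<Sum>d\<in>?L. \<Sum>b\<in>?L. (cnj (U d b) * U d c) * (\<psi> c * cnj (\<psi> b)))"
    by (rule sum.swap)
  also have "\<dots> = (\<Sum>c\<in>?L. \<Sum>b\<in>?L. \<Sum>d\<in>?L. (cnj (U d b) * U d c) * (\<psi> c * cnj (\<psi> b)))"
    by (intro sum.cong refl sum.swap)
  also have "\<dots> = (\<Sum>c\<in>?L. \<Sum>b\<in>?L. (\<Sum>d\<in>?L. cnj (U d b) * U d c) * (\<psi> c * cnj (\<psi> b)))"
    by (simp only: sum_distrib_right)
  also have "\<dots> = (\<Sum>c\<in>?L. \<Sum>b\<in>?L. of_bool (b = c) * (\<psi> c * cnj (\<psi> b)))"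
    using assms by (intro sum.cong refl) (simp add: unitary_op_def)
  also have "\<dots> = (\<Sum>c\<in>?L. \<Sum>b\<in>?L. if b = c then \<psi> c * cnj (\<psi> b) else 0)"
    by (intro sum.cong refl) simp
  also have "\<dots> = complex_of_real (normsq n s \<psi>)"
    by (simp add: normsq_def complex_norm_square del: of_real_power)
  finally show ?thesis
    by (simp only: of_real_eq_iff)
qed

lemma normsq_measure:
  "(\<Sum>k\<in>L ` labels n s. normsq n s (\<lambda>b. if L b = k then \<psi> b else 0)) = normsq n s \<psi>"
proof -
  have "(\<Sum>k\<in>L ` labels n s. normsq n s (\<lambda>b. if L b = k then \<psi> b else 0))
      = (\<Sum>b\<in>labels n s. \<Sum>k\<in>L ` labels n s. if L b = k then (cmod (\<psi> b))\<^sup>2 else 0)"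
    unfolding normsq_def by (subst sum.swap) (intro sum.cong refl, simp)
  also have "\<dots> = normsq n s \<psi>"
    unfolding normsq_def by (intro sum.cong refl) simp
  finally show ?thesis .
qed

lemma run_prob_total:
  "valid_qalg n s A \<Longrightarrow> run_prob n s f g A \<psi> (\<lambda>_ _ _. True) = normsq n s \<psi>"
  by (induction A arbitrary: \<psi>)
     (simp_all add: normsq_unitary normsq_oracle normsq_measure)

lemma normsq_init_state: "normsq n s (init_state n s) = 1"
proof -
  let ?z = "(replicate n False, False, replicate s False)"
  have "normsq n s (init_state n s) = (\<Sum>b\<in>labels n s. if b = ?z then 1 else 0)"
    unfolding normsq_def init_state_def by (intro sum.cong refl) simp
  also have "\<dots> = (if ?z \<in> labels n s then 1 else 0)"
    by (rule sum.delta) simp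
  also have "\<dots> = 1"
    by (simp add: labels_def cube_def)
  finally show ?thesis .
qed

lemma alg_prob_total: "valid_qalg n s A \<Longrightarrow> alg_prob n s f g A (\<lambda>_ _ _. True) = 1"
  by (simp add: run_prob_total normsq_init_state)

end

theory Submission
  imports Defs "HOL-Combinatorics.Transposition"
begin

text \<open>
  With one query to each function one can prepare
  \<open>\<phi> = (\<Sum>x z. f x * g (x XOR z) |x>|z>) / 2 ^ n\<close>.  Projecting the first register of \<open>\<phi>\<close> onto
  the uniform superposition leaves \<open>|z>\<close> with amplitude \<open>C z / 2 ^ (3 * n / 2)\<close>.  Hence the
  projection of \<open>\<phi>\<close> onto the good subspace (first register uniform, \<open>wt z \<le> m\<close>) has squared norm
  \<open>a\<^sup>2\<close>, and measuring there yields a \<open>z\<close> with \<open>C z \<noteq> 0\<close>.  Amplitude amplification with \<open>j\<close> steps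
  turns \<open>a = sin \<theta>\<close> into \<open>sin ((2 * j + 1) * \<theta>)\<close> at the cost of \<open>2 * j + 1\<close> queries to each function.
  As \<open>a\<close> is unknown, the numbers \<open>2 * j + 1 = 1, 3, 9, \<dots>\<close> are tried in turn: the last
  \<open>3 ^ i\<close> with \<open>3 ^ i * \<theta> \<le> pi / 2\<close> gives a sine of at least \<open>1 / 2\<close>, and the queries made until
  then form a geometric sum of size at most \<open>3 / a\<close>.  Since \<open>a \<ge> 1 / 4 ^ n\<close> unless \<open>a = 0\<close>,
  \<open>2 * n + 2\<close> stages suffice.
\<close>

section \<open>Sums over labels and runs of algorithms\<close>

lemma sum_labels:
  fixes F :: "label \<Rightarrow> 'a::comm_monoid_add"
  shows "(\<Sum>b\<in>labels n s. F b) = (\<Sum>x\<in>cube n. \<Sum>z\<in>cube s. F (x, False, z) + F (x, True, z))"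
proof -
  have "(\<Sum>b\<in>labels n s. F b) = (\<Sum>x\<in>cube n. \<Sum>a\<in>UNIV. \<Sum>z\<in>cube s. F (x, a, z))"
    unfolding labels_def by (simp add: sum.cartesian_product case_prod_unfold)
  also have "\<dots> = (\<Sum>x\<in>cube n. \<Sum>z\<in>cube s. F (x, False, z) + F (x, True, z))"
    by (simp add: UNIV_bool sum.distrib)
  finally show ?thesis .
qed

lemma apply_op_cmult:
  "apply_op n s U (\<lambda>b. k * \<psi> b) = (\<lambda>b. k * apply_op n s U \<psi> b)"
  by (auto simp: apply_op_def sum_distrib_left mult.left_commute)

lemma normsq_cmult: "normsq n s (\<lambda>b. k * \<psi> b) = (cmod k)\<^sup>2 * normsq n s \<psi>"
  by (simp add: normsq_def norm_mult power_mult_distrib sum_distrib_left)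

text \<open>States are not renormalized after a measurement, so a scalar leaves a run as its squared
  modulus. This separates the probability of an outcome from the run that continues on a basis
  vector.\<close>

lemma run_prob_cmult:
  "run_prob n s f g A (\<lambda>b. k * \<psi> b) E = (cmod k)\<^sup>2 * run_prob n s f g A \<psi> E"
proof (induction A arbitrary: \<psi> E)
  case (Measure L A)
  have "(\<lambda>b. if L b = j then k * \<psi> b else 0) = (\<lambda>b. k * (if L b = j then \<psi> b else 0))" for j
    by auto
  then show ?case
    by (simp add: Measure sum_distrib_left)
qed (simp_all add: apply_op_cmult normsq_cmult)

lemma run_prob_nonneg: "run_prob n s f g A \<psi> E \<ge> 0"
  by (induction A arbitrary: \<psi> E) (auto simp: normsq_def intro!: sum_nonneg)

section \<open>Permutation and reflection operators\<close>

definition perm_op :: "(label \<Rightarrow> label) \<Rightarrow> qop" where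
  "perm_op \<pi> = (\<lambda>b c. of_bool (b = \<pi> c))"

lemma complex_cnj_of_bool: "cnj (of_bool P) = of_bool P"
  by simp

text \<open>As \<open>\<pi>\<close> is its own inverse on the labels, its matrix there is a
  symmetric permutation matrix, so column products reduce to row products.\<close>

lemma perm_op_involution:
  assumes "\<And>b. b \<in> labels n s \<Longrightarrow> \<pi> b \<in> labels n s \<and> \<pi> (\<pi> b) = b"
  shows unitary_perm_op: "unitary_op n s (perm_op \<pi>)"
    and apply_perm_op: "apply_op n s (perm_op \<pi>) \<psi> = (\<lambda>b. if b \<in> labels n s then \<psi> (\<pi> b) else 0)"
proof -
  let ?L = "labels n s"
  have eq: "b = \<pi> c \<longleftrightarrow> c = \<pi> b" if "b \<in> ?L" "c \<in> ?L" for b c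
    using assms that by metis
  have delta: "(\<Sum>c\<in>?L. of_bool (b = \<pi> c) * F c) = F (\<pi> b)" if "b \<in> ?L" for b and F :: qstate
  proof -
    have "(\<Sum>c\<in>?L. of_bool (b = \<pi> c) * F c) = (\<Sum>c\<in>?L. if c = \<pi> b then F c else 0)"
      using that by (intro sum.cong refl) (simp add: eq)
    also have "\<dots> = F (\<pi> b)"
      using assms that by simp
    finally show ?thesis .
  qed
  show "apply_op n s (perm_op \<pi>) \<psi> = (\<lambda>b. if b \<in> ?L then \<psi> (\<pi> b) else 0)"
    unfolding apply_op_def perm_op_def by (intro ext if_cong refl delta)
  have row: "(\<Sum>d\<in>?L. of_bool (b = \<pi> d) * of_bool (c = \<pi> d)) = (of_bool (b = c) :: complex)"
    if "b \<in> ?L" "c \<in> ?L" for b c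
    using that assms by (subst delta) (auto simp: of_bool_def)
  have col: "(\<Sum>d\<in>?L. of_bool (d = \<pi> b) * of_bool (d = \<pi> c)) = (of_bool (b = c) :: complex)"
    if "b \<in> ?L" "c \<in> ?L" for b c
  proof -
    have "(\<Sum>d\<in>?L. of_bool (d = \<pi> b) * of_bool (d = \<pi> c)) =
        (\<Sum>d\<in>?L. of_bool (b = \<pi> d) * of_bool (c = \<pi> d) :: complex)"
      using that by (intro sum.cong refl arg_cong2[where f = "(*)"] arg_cong[where f = of_bool] eq)
    then show ?thesis using row that by simp
  qed
  show "unitary_op n s (perm_op \<pi>)"
    unfolding unitary_op_def perm_op_def
    by (intro ballI conjI) (simp_all only: complex_cnj_of_bool row col)
qed

text \<open>For orthogonal \<open>r k\<close> of squared norm 2 this is \<open>1 - 2 P\<close> with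
  P the projection onto their span; the norm absorbs the factor 2.\<close>

definition refl_op :: "'k set \<Rightarrow> ('k \<Rightarrow> label \<Rightarrow> real) \<Rightarrow> qop" where
  "refl_op I r = (\<lambda>b c. complex_of_real (of_bool (b = c) - (\<Sum>k\<in>I. r k b * r k c)))"

text \<open>\<open>S\<close> is twice a projection, so \<open>S S = 2 S\<close> and
  \<open>(1 - S) (1 - S) = 1\<close>. The matrix is real and symmetric, so this is
  unitarity.\<close>

lemma unitary_refl_op:
  assumes fin: "finite I"
    and orth: "\<And>k l. k \<in> I \<Longrightarrow> l \<in> I \<Longrightarrow> (\<Sum>b\<in>labels n s. r k b * r l b) = 2 * of_bool (k = l)"
  shows "unitary_op n s (refl_op I r)"
proof -
  let ?L = "labels n s"
  define S where "S b c = (\<Sum>k\<in>I. r k b * r k c)" for b c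
  have sym: "S b c = S c b" for b c
    by (simp add: S_def mult.commute)
  have SS: "(\<Sum>d\<in>?L. S d b * S d c) = 2 * S b c" for b c
  proof -
    have "(\<Sum>d\<in>?L. S d b * S d c) = (\<Sum>d\<in>?L. \<Sum>k\<in>I. \<Sum>l\<in>I. (r k d * r l d) * (r k b * r l c))"
      by (simp add: S_def sum_product algebra_simps)
    also have "\<dots> = (\<Sum>k\<in>I. \<Sum>d\<in>?L. \<Sum>l\<in>I. (r k d * r l d) * (r k b * r l c))"
      by (rule sum.swap)
    also have "\<dots> = (\<Sum>k\<in>I. \<Sum>l\<in>I. \<Sum>d\<in>?L. (r k d * r l d) * (r k b * r l c))"
      by (intro sum.cong refl sum.swap)
    also have "\<dots> = (\<Sum>k\<in>I. \<Sum>l\<in>I. 2 * of_bool (k = l) * (r k b * r l c))"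
      by (intro sum.cong refl) (simp add: orth flip: sum_distrib_right)
    also have "\<dots> = (\<Sum>k\<in>I. \<Sum>l\<in>I. if k = l then 2 * (r k b * r l c) else 0)"
      by (intro sum.cong refl) simp
    also have "\<dots> = 2 * S b c"
      using fin by (simp add: S_def sum_distrib_left)
    finally show ?thesis .
  qed
  define R where "R b c = of_bool (b = c) - S b c" for b c
  have delta: "(\<Sum>d\<in>?L. of_bool (d = b) * F d) = F b" if "b \<in> ?L" for b and F :: "label \<Rightarrow> real"
    using that by (simp add: of_bool_def if_distrib[where f = "\<lambda>x. x * _"] cong: if_cong)
  have RR: "(\<Sum>d\<in>?L. R d b * R d c) = of_bool (b = c)" if "b \<in> ?L" "c \<in> ?L" for b c
  proof -
    have "(\<Sum>d\<in>?L. R d b * R d c) =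
        (\<Sum>d\<in>?L. of_bool (d = b) * of_bool (d = c) - of_bool (d = b) * S d c
          - of_bool (d = c) * S d b + S d b * S d c)"
      by (simp add: R_def algebra_simps)
    also have "\<dots> = of_bool (b = c) - S b c - S c b + 2 * S b c"
      using that by (simp only: sum.distrib sum_subtractf delta SS)
    finally show ?thesis using sym by simp
  qed
  have symR: "R b c = R c b" for b c
    using sym by (auto simp: R_def)
  have RR': "(\<Sum>d\<in>?L. R b d * R c d) = of_bool (b = c)" if "b \<in> ?L" "c \<in> ?L" for b c
    using RR[OF that] symR by simp
  have op: "refl_op I r b c = complex_of_real (R b c)" for b c
    by (simp add: refl_op_def R_def S_def)
  show ?thesis
    unfolding unitary_op_def op complex_cnj_complex_of_real of_real_mult[symmetric]
      of_real_sum[symmetric]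
    by (simp add: RR RR')
qed

lemma apply_refl_op:
  assumes "\<And>b. b \<in> labels n s \<Longrightarrow> \<psi> b = complex_of_real (u b)"
  shows "apply_op n s (refl_op I r) \<psi> = (\<lambda>b. if b \<in> labels n s
    then complex_of_real (u b - (\<Sum>k\<in>I. r k b * (\<Sum>c\<in>labels n s. r k c * u c))) else 0)"
proof -
  let ?L = "labels n s"
  have "(\<Sum>c\<in>?L. (of_bool (b = c) - (\<Sum>k\<in>I. r k b * r k c)) * u c)
      = u b - (\<Sum>k\<in>I. r k b * (\<Sum>c\<in>?L. r k c * u c))" if "b \<in> ?L" for b
  proof -
    have "(\<Sum>c\<in>?L. (of_bool (b = c) - (\<Sum>k\<in>I. r k b * r k c)) * u c)
        = (\<Sum>c\<in>?L. (if b = c then u c else 0) - (\<Sum>k\<in>I. r k b * (r k c * u c)))"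
      by (intro sum.cong refl) (simp add: left_diff_distrib sum_distrib_right mult.assoc)
    also have "\<dots> = u b - (\<Sum>c\<in>?L. \<Sum>k\<in>I. r k b * (r k c * u c))"
      using that by (simp add: sum_subtractf)
    also have "(\<Sum>c\<in>?L. \<Sum>k\<in>I. r k b * (r k c * u c))
        = (\<Sum>k\<in>I. \<Sum>c\<in>?L. r k b * (r k c * u c))"
      by (rule sum.swap)
    finally show ?thesis by (simp add: sum_distrib_left)
  qed
  moreover have "(\<Sum>c\<in>?L. refl_op I r b c * \<psi> c)
      = complex_of_real (\<Sum>c\<in>?L. (of_bool (b = c) - (\<Sum>k\<in>I. r k b * r k c)) * u c)" for b
    unfolding of_real_sum by (intro sum.cong refl) (simp only: refl_op_def assms of_real_mult)
  ultimately show ?thesis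
    unfolding apply_op_def by (intro ext) (simp only: cong: if_cong)
qed

text \<open>Exchanges each basis vector \<open>e k\<close> with the unit vector \<open>p k\<close>.\<close>

definition householder :: "'k set \<Rightarrow> ('k \<Rightarrow> label) \<Rightarrow> ('k \<Rightarrow> label \<Rightarrow> real) \<Rightarrow> qop" where
  "householder I e p = refl_op I (\<lambda>k b. (of_bool (b = e k) - p k b) / sqrt (1 - p k (e k)))"

text \<open>The differences \<open>e k - p k\<close> have squared norm
  \<open>2 * (1 - p k (e k))\<close>, positive by \<open>p_less\<close>, and are pairwise orthogonal
  by \<open>e_inj\<close>, \<open>p_orth\<close> and \<open>p_other\<close>. Divided by
  \<open>sqrt (1 - p k (e k))\<close> they fit \<open>unitary_refl_op\<close>.\<close>

locale orthonormal_family =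
  fixes n s :: nat and I :: "'k set" and e :: "'k \<Rightarrow> label" and p :: "'k \<Rightarrow> label \<Rightarrow> real"
  assumes fin: "finite I"
    and e_label: "\<And>k. k \<in> I \<Longrightarrow> e k \<in> labels n s"
    and e_inj: "inj_on e I"
    and p_orth: "\<And>k l. k \<in> I \<Longrightarrow> l \<in> I \<Longrightarrow> (\<Sum>b\<in>labels n s. p k b * p l b) = of_bool (k = l)"
    and p_other: "\<And>k l. k \<in> I \<Longrightarrow> l \<in> I \<Longrightarrow> k \<noteq> l \<Longrightarrow> p k (e l) = 0"
    and p_less: "\<And>k. k \<in> I \<Longrightarrow> p k (e k) < 1"
begin

lemma sum_delta_e: "k \<in> I \<Longrightarrow> (\<Sum>b\<in>labels n s. of_bool (b = e k) * F b) = (F (e k) :: real)"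
  using e_label by (simp add: of_bool_def if_distrib[where f = "\<lambda>x. x * _"] cong: if_cong)

lemma unitary_householder: "unitary_op n s (householder I e p)"
  unfolding householder_def
proof (rule unitary_refl_op[OF fin])
  fix k l assume kl: "k \<in> I" "l \<in> I"
  let ?D = "sqrt (1 - p k (e k)) * sqrt (1 - p l (e l))"
  have "(\<Sum>b\<in>labels n s. (of_bool (b = e k) - p k b) * (of_bool (b = e l) - p l b))
      = (\<Sum>b\<in>labels n s. of_bool (b = e k) * of_bool (b = e l) - of_bool (b = e k) * p l b
          - of_bool (b = e l) * p k b + p k b * p l b)"
    by (simp add: algebra_simps)
  also have "\<dots> = of_bool (e k = e l) - p l (e k) - p k (e l) + of_bool (k = l)"
    using kl by (simp only: sum.distrib sum_subtractf sum_delta_e p_orth)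
  also have "\<dots> = 2 * of_bool (k = l) * ?D"
  proof (cases "k = l")
    case True
    then show ?thesis using p_less[of k] kl by simp
  next
    case False
    then show ?thesis using kl p_other[of k l] p_other[of l k] e_inj by (auto dest: inj_onD)
  qed
  finally have num: "(\<Sum>b\<in>labels n s. (of_bool (b = e k) - p k b) * (of_bool (b = e l) - p l b))
      = 2 * of_bool (k = l) * ?D" .
  have "?D \<noteq> 0"
    using p_less[of k] p_less[of l] kl by auto
  then show "(\<Sum>b\<in>labels n s. (of_bool (b = e k) - p k b) / sqrt (1 - p k (e k)) *
      ((of_bool (b = e l) - p l b) / sqrt (1 - p l (e l)))) = 2 * of_bool (k = l)"
    using num by (simp flip: sum_divide_distrib)
qed

text \<open>The reflection is symmetric and sends \<open>e k\<close> to \<open>p k\<close>, so its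
  output at \<open>e k\<close> is the inner product with \<open>p k\<close>.\<close>

lemma householder_at_e:
  assumes "k \<in> I" and \<psi>: "\<And>b. b \<in> labels n s \<Longrightarrow> \<psi> b = complex_of_real (u b)"
  shows "apply_op n s (householder I e p) \<psi> (e k) = complex_of_real (\<Sum>b\<in>labels n s. p k b * u b)"
proof -
  define d where "d = (\<lambda>l. sqrt (1 - p l (e l)))"
  define r where "r = (\<lambda>l b. (of_bool (b = e l) - p l b) / d l)"
  have hh: "householder I e p = refl_op I r"
    by (simp add: householder_def r_def d_def)
  \<comment> \<open>Only the \<open>k\<close>-th reflection vector is nonzero at \<open>e k\<close>:
    injectivity of \<open>e\<close> removes the delta, \<open>p_other\<close> the rest.\<close>
  have z: "r l (e k) = 0" if "l \<in> I" "l \<noteq> k" for l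
    using that assms(1) p_other[of l k] e_inj by (auto simp: r_def dest: inj_onD)
  have "(\<Sum>b\<in>labels n s. r k b * u b)
      = (\<Sum>b\<in>labels n s. of_bool (b = e k) * u b - p k b * u b) / d k"
    by (simp add: r_def sum_divide_distrib left_diff_distrib)
  also have "\<dots> = (u (e k) - (\<Sum>b\<in>labels n s. p k b * u b)) / d k"
    using assms(1) by (simp only: sum_subtractf sum_delta_e)
  finally have ip: "(\<Sum>b\<in>labels n s. r k b * u b)
      = (u (e k) - (\<Sum>b\<in>labels n s. p k b * u b)) / d k" .
  have "(\<Sum>l\<in>I. r l (e k) * (\<Sum>b\<in>labels n s. r l b * u b))
      = r k (e k) * (\<Sum>b\<in>labels n s. r k b * u b)"
    using fin assms(1) z by (subst sum.remove[of _ k]) (simp_all add: sum.neutral)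
  also have "\<dots> = u (e k) - (\<Sum>b\<in>labels n s. p k b * u b)"
    unfolding ip using p_less[OF assms(1)] by (simp add: r_def d_def field_simps)
  finally have "(\<Sum>l\<in>I. r l (e k) * (\<Sum>b\<in>labels n s. r l b * u b))
      = u (e k) - (\<Sum>b\<in>labels n s. p k b * u b)" .
  then show ?thesis
    by (simp only: hh apply_refl_op[OF \<psi>] e_label[OF assms(1)] if_True diff_diff_eq2
        add_diff_cancel_left')
qed

lemma householder_e:
  assumes "k \<in> I"
  shows "apply_op n s (householder I e p) (\<lambda>b. of_bool (b = e k))
    = (\<lambda>b. if b \<in> labels n s then complex_of_real (p k b) else 0)"
proof -
  define d where "d = (\<lambda>l. sqrt (1 - p l (e l)))"
  define r where "r = (\<lambda>l b. (of_bool (b = e l) - p l b) / d l)"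
  have hh: "householder I e p = refl_op I r"
    by (simp add: householder_def r_def d_def)
  have ip: "(\<Sum>b\<in>labels n s. r l b * of_bool (b = e k)) = r l (e k)" for l
    using sum_delta_e[OF assms, of "r l"] by (simp add: mult.commute)
  have z: "r l (e k) = 0" if "l \<in> I" "l \<noteq> k" for l
    using that assms p_other[of l k] e_inj by (auto simp: r_def dest: inj_onD)
  have rr: "(\<Sum>l\<in>I. r l b * r l (e k)) = of_bool (b = e k) - p k b" for b
  proof -
    have "(\<Sum>l\<in>I. r l b * r l (e k)) = r k b * r k (e k)"
      using fin assms z by (subst sum.remove[of _ k]) (simp_all add: sum.neutral)
    also have "\<dots> = of_bool (b = e k) - p k b"
      using p_less[OF assms] by (simp add: r_def d_def field_simps)
    finally show ?thesis .
  qed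
  have "apply_op n s (refl_op I r) (\<lambda>b. of_bool (b = e k))
    = (\<lambda>b. if b \<in> labels n s then complex_of_real (of_bool (b = e k) -
        (\<Sum>l\<in>I. r l b * (\<Sum>b\<in>labels n s. r l b * of_bool (b = e k)))) else 0)"
    by (rule apply_refl_op) simp
  then show ?thesis
    unfolding hh ip rr by (simp only: diff_diff_eq2 add_diff_cancel_left')
qed

end

section \<open>States with the target qubit in the phase state\<close>

lemma card_cube: "card (cube n) = 2 ^ n"
  using card_lists_length_eq[of "UNIV :: bool set" n] by (simp add: cube_def)

lemma xor_list_cube: "x \<in> cube n \<Longrightarrow> y \<in> cube n \<Longrightarrow> xor_list x y \<in> cube n"
  by (simp add: cube_def xor_list_def)

lemma xor_list_cancel: "x \<in> cube n \<Longrightarrow> y \<in> cube n \<Longrightarrow> xor_list (xor_list x y) y = x"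
  by (auto simp: cube_def xor_list_def intro!: nth_equalityI)

text \<open>
  The target qubit is kept in the state \<open>(|0> - |1>) / sqrt 2\<close>, so that an oracle acts by
  multiplication with its function; \<open>A x z\<close> is the amplitude of input \<open>x\<close> and workspace \<open>z\<close>.
\<close>

definition phase_vec :: "(bool list \<Rightarrow> bool list \<Rightarrow> real) \<Rightarrow> label \<Rightarrow> real" where
  "phase_vec A = (\<lambda>(x, a, z). (if a then -1 else 1) * A x z / sqrt 2)"

definition phase_state :: "nat \<Rightarrow> (bool list \<Rightarrow> bool list \<Rightarrow> real) \<Rightarrow> qstate" where
  "phase_state n A = (\<lambda>b. if b \<in> labels n n then complex_of_real (phase_vec A b) else 0)"

lemma inner_phase_vec:
  "(\<Sum>b\<in>labels n s. phase_vec A b * phase_vec B b) = (\<Sum>x\<in>cube n. \<Sum>z\<in>cube s. A x z * B x z)"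
  by (simp add: sum_labels phase_vec_def)

lemma phase_state_cong:
  "(\<And>x z. x \<in> cube n \<Longrightarrow> z \<in> cube n \<Longrightarrow> A x z = B x z) \<Longrightarrow> phase_state n A = phase_state n B"
  by (auto simp: phase_state_def phase_vec_def labels_def fun_eq_iff)

lemma apply_refl_phase_state:
  "apply_op n n (refl_op I (\<lambda>k. phase_vec (B k))) (phase_state n A) =
    phase_state n (\<lambda>x z. A x z - (\<Sum>k\<in>I. B k x z * (\<Sum>x\<in>cube n. \<Sum>z\<in>cube n. B k x z * A x z)))"
proof -
  have lin: "phase_vec A b - (\<Sum>k\<in>I. phase_vec (B k) b * c k)
      = phase_vec (\<lambda>x z. A x z - (\<Sum>k\<in>I. B k x z * c k)) b" for b c
    by (cases b) (simp add: phase_vec_def diff_divide_distrib sum_divide_distrib sum_negf)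
  show ?thesis
    by (subst apply_refl_op[where u = "phase_vec A"])
       (simp_all add: phase_state_def inner_phase_vec lin cong: if_cong)
qed

text \<open>Phase kickback: where \<open>f x = -1\<close> the oracle swaps the two target values,
  which negates the amplitude.\<close>

lemma apply_oracle_phase_state:
  assumes "f \<in> cube n \<rightarrow> {1, -1}"
  shows "apply_op n n (oracle_op f None) (phase_state n A) =
    phase_state n (\<lambda>x z. real_of_int (f x) * A x z)"
proof -
  have "f x = 1 \<or> f x = -1" if "x \<in> cube n" for x
    using assms that by auto
  then show ?thesis
    by (fastforce simp: apply_oracle_op phase_state_def phase_vec_def fun_eq_iff oracle_map_labels
        oracle_map_def labels_def)
qed

definition xor_map :: "label \<Rightarrow> label" where
  "xor_map = (\<lambda>(x, a, z). (xor_list x z, a, z))"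

lemma xor_map_involution: "b \<in> labels n n \<Longrightarrow> xor_map b \<in> labels n n \<and> xor_map (xor_map b) = b"
  by (auto simp: xor_map_def labels_def xor_list_cube xor_list_cancel)

lemma unitary_xor_op: "unitary_op n n (perm_op xor_map)"
  by (rule unitary_perm_op) (rule xor_map_involution)

lemma apply_xor_phase_state:
  "apply_op n n (perm_op xor_map) (phase_state n A) = phase_state n (\<lambda>x z. A (xor_list x z) z)"
proof -
  have "apply_op n n (perm_op xor_map) (phase_state n A)
      = (\<lambda>b. if b \<in> labels n n then phase_state n A (xor_map b) else 0)"
    by (rule apply_perm_op) (rule xor_map_involution)
  then show ?thesis
    by (auto simp: phase_state_def phase_vec_def labels_def xor_list_cube xor_map_def fun_eq_iff)
qed

section \<open>Unitaries of the algorithm and their action on phase states\<close>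

definition prep_op :: "nat \<Rightarrow> qop" where
  "prep_op n = householder {()} (\<lambda>_. (replicate n False, False, replicate n False))
     (\<lambda>_. phase_vec (\<lambda>_ _. 1 / 2 ^ n))"

text \<open>Turns the projection onto uniform input register and phase-state target into a
  measurement of labels: for each \<open>z\<close> that state is exchanged with a basis
  vector.\<close>

definition readout_op :: "nat \<Rightarrow> qop" where
  "readout_op n = householder (cube n) (\<lambda>z. (replicate n False, False, z))
     (\<lambda>z. phase_vec (\<lambda>_ z'. of_bool (z' = z) / sqrt (2 ^ n)))"

text \<open>The factor \<open>sqrt 2\<close>, here and in \<open>refl_good_op\<close>, supplies the
  squared norm 2 that \<open>refl_op\<close> expects.\<close>

definition refl_uniform_op :: "nat \<Rightarrow> qop" where
  "refl_uniform_op n = refl_op {()} (\<lambda>_. phase_vec (\<lambda>_ _. sqrt 2 / 2 ^ n))"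

definition refl_good_op :: "nat \<Rightarrow> nat \<Rightarrow> qop" where
  "refl_good_op n m = refl_op {z\<in>cube n. wt z \<le> m}
     (\<lambda>z. phase_vec (\<lambda>_ z'. sqrt 2 * of_bool (z' = z) / sqrt (2 ^ n)))"

lemma replicate_cube: "replicate n a \<in> cube n"
  by (simp add: cube_def)

text \<open>Serves \<open>p_less\<close> in both interpretations; the factor
  \<open>1 / sqrt 2\<close> of the target qubit makes the bound strict even for
  \<open>n = 0\<close>.\<close>

lemma inv_sqrt2_less: "1 / (sqrt 2 * c) < 1" if "c \<ge> 1"
proof -
  have "1 * 1 < sqrt 2 * c"
    using that by (intro mult_less_le_imp_less) auto
  then show ?thesis by simp
qed

interpretation prep: orthonormal_family n n "{()}"
  "\<lambda>_. (replicate n False, False, replicate n False)" "\<lambda>_. phase_vec (\<lambda>_ _. 1 / 2 ^ n)"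
proof
  fix k show "phase_vec (\<lambda>_ _. 1 / 2 ^ n) (replicate n False, False, replicate n False) < 1"
    using inv_sqrt2_less[of "2 ^ n"] by (simp add: phase_vec_def mult.commute)
  fix l show "(\<Sum>b\<in>labels n n. phase_vec (\<lambda>_ _. 1 / 2 ^ n) b * phase_vec (\<lambda>_ _. 1 / 2 ^ n) b)
      = of_bool (k = (l :: unit))"
    by (simp add: inner_phase_vec card_cube)
qed (simp_all add: labels_def replicate_cube)

lemma sum_mult_of_bool_eq:
  fixes F :: "'a \<Rightarrow> real"
  shows "finite S \<Longrightarrow> (\<Sum>y\<in>S. of_bool (y = a) * F y) = (if a \<in> S then F a else 0)"
    "finite S \<Longrightarrow> (\<Sum>y\<in>S. of_bool (a = y) * F y) = (if a \<in> S then F a else 0)"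
  by (simp_all add: of_bool_def if_distrib[where f = "\<lambda>x. x * _"] cong: if_cong)

interpretation readout: orthonormal_family n n "cube n"
  "\<lambda>z. (replicate n False, False, z)" "\<lambda>z. phase_vec (\<lambda>_ z'. of_bool (z' = z) / sqrt (2 ^ n))"
proof
  fix k l assume kl: "k \<in> cube n" "l \<in> cube n"
  have "(\<Sum>b\<in>labels n n. phase_vec (\<lambda>_ z'. of_bool (z' = k) / sqrt (2 ^ n)) b *
      phase_vec (\<lambda>_ z'. of_bool (z' = l) / sqrt (2 ^ n)) b) =
      (\<Sum>x\<in>cube n. \<Sum>z\<in>cube n. of_bool (z = k) * (of_bool (z = l) / 2 ^ n))"
    unfolding inner_phase_vec by (intro sum.cong refl) simp
  also have "\<dots> = of_bool (k = l)"
    using kl by (simp only: sum_mult_of_bool_eq finite_cube) (simp add: card_cube)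
  finally show "(\<Sum>b\<in>labels n n. phase_vec (\<lambda>_ z'. of_bool (z' = k) / sqrt (2 ^ n)) b *
      phase_vec (\<lambda>_ z'. of_bool (z' = l) / sqrt (2 ^ n)) b) = of_bool (k = l)" .
next
  fix k assume "k \<in> cube n"
  show "phase_vec (\<lambda>_ z'. of_bool (z' = k) / sqrt (2 ^ n)) (replicate n False, False, k) < 1"
    using inv_sqrt2_less[of "sqrt (2 ^ n)"] by (simp add: phase_vec_def mult.commute)
qed (auto simp: labels_def replicate_cube phase_vec_def inj_on_def)

lemma unitary_prep_op: "unitary_op n n (prep_op n)"
  unfolding prep_op_def by (rule prep.unitary_householder)

lemma unitary_readout_op: "unitary_op n n (readout_op n)"
  unfolding readout_op_def by (rule readout.unitary_householder)

lemma unitary_refl_uniform_op: "unitary_op n n (refl_uniform_op n)"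
  unfolding refl_uniform_op_def
  by (rule unitary_refl_op) (simp_all add: inner_phase_vec card_cube)

lemma unitary_refl_good_op: "unitary_op n n (refl_good_op n m)"
  unfolding refl_good_op_def
proof (rule unitary_refl_op)
  fix k l assume kl: "k \<in> {z\<in>cube n. wt z \<le> m}" "l \<in> {z\<in>cube n. wt z \<le> m}"
  have "(\<Sum>b\<in>labels n n. phase_vec (\<lambda>_ z'. sqrt 2 * of_bool (z' = k) / sqrt (2 ^ n)) b *
      phase_vec (\<lambda>_ z'. sqrt 2 * of_bool (z' = l) / sqrt (2 ^ n)) b) =
      (\<Sum>x\<in>cube n. \<Sum>z\<in>cube n. of_bool (z = k) * (2 * of_bool (z = l) / 2 ^ n))"
    unfolding inner_phase_vec by (intro sum.cong refl) simp
  also have "\<dots> = 2 * of_bool (k = l)"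
    using kl by (simp only: sum_mult_of_bool_eq finite_cube) (simp add: card_cube)
  finally show "(\<Sum>b\<in>labels n n. phase_vec (\<lambda>_ z'. sqrt 2 * of_bool (z' = k) / sqrt (2 ^ n)) b *
      phase_vec (\<lambda>_ z'. sqrt 2 * of_bool (z' = l) / sqrt (2 ^ n)) b) = 2 * of_bool (k = l)" .
qed simp

lemma apply_prep_op: "apply_op n n (prep_op n) (init_state n n) = phase_state n (\<lambda>_ _. 1 / 2 ^ n)"
  unfolding prep_op_def init_state_def phase_state_def by (rule prep.householder_e) simp

lemma apply_readout_op:
  assumes "z \<in> cube n"
  shows "apply_op n n (readout_op n) (phase_state n A) (replicate n False, False, z)
    = complex_of_real ((\<Sum>x\<in>cube n. A x z) / sqrt (2 ^ n))"
proof -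
  have "apply_op n n (readout_op n) (phase_state n A) (replicate n False, False, z) =
      complex_of_real (\<Sum>b\<in>labels n n.
        phase_vec (\<lambda>_ z'. of_bool (z' = z) / sqrt (2 ^ n)) b * phase_vec A b)"
    unfolding readout_op_def
    by (rule readout.householder_at_e[OF assms]) (simp add: phase_state_def)
  also have "(\<Sum>b\<in>labels n n. phase_vec (\<lambda>_ z'. of_bool (z' = z) / sqrt (2 ^ n)) b * phase_vec A b)
      = (\<Sum>x\<in>cube n. \<Sum>z'\<in>cube n. of_bool (z' = z) * (A x z' / sqrt (2 ^ n)))"
    unfolding inner_phase_vec by simp
  also have "\<dots> = (\<Sum>x\<in>cube n. A x z) / sqrt (2 ^ n)"
    using assms by (simp only: sum_mult_of_bool_eq finite_cube sum_divide_distrib if_True)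
  finally show ?thesis .
qed

lemma apply_refl_uniform_op:
  "apply_op n n (refl_uniform_op n) (phase_state n A) =
    phase_state n (\<lambda>x z. A x z - 2 / 4 ^ n * (\<Sum>x\<in>cube n. \<Sum>z\<in>cube n. A x z))"
  unfolding refl_uniform_op_def apply_refl_phase_state
  by (rule phase_state_cong)
     (simp add: sum_distrib_left[symmetric] sum_divide_distrib[symmetric] power_mult_distrib[symmetric])

text \<open>In each column \<open>z\<close> of weight at most \<open>m\<close>, projecting onto the
  uniform vector replaces the entries by their mean over \<open>x\<close>; the reflection subtracts
  it twice.\<close>

lemma apply_refl_good_op:
  "apply_op n n (refl_good_op n m) (phase_state n A) =
    phase_state n (\<lambda>x z. A x z - of_bool (wt z \<le> m) * (2 / 2 ^ n * (\<Sum>x\<in>cube n. A x z)))"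
  unfolding refl_good_op_def apply_refl_phase_state
proof (rule phase_state_cong)
  fix x z assume "x \<in> cube n" "z \<in> cube n"
  let ?G = "{z\<in>cube n. wt z \<le> m}"
  let ?B = "\<lambda>k z'. sqrt 2 * of_bool (z' = k) / sqrt (2 ^ n) :: real"
  have ip: "(\<Sum>x\<in>cube n. \<Sum>z\<in>cube n. ?B k z * A x z) = sqrt 2 / sqrt (2 ^ n) * (\<Sum>x\<in>cube n. A x k)"
    if "k \<in> ?G" for k
  proof -
    have "(\<Sum>x\<in>cube n. \<Sum>z\<in>cube n. ?B k z * A x z) =
        (\<Sum>x\<in>cube n. \<Sum>z\<in>cube n. of_bool (z = k) * (sqrt 2 / sqrt (2 ^ n) * A x z))"
      by (simp add: algebra_simps)
    also have "\<dots> = sqrt 2 / sqrt (2 ^ n) * (\<Sum>x\<in>cube n. A x k)"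
      using that by (simp only: sum_mult_of_bool_eq finite_cube sum_distrib_left) simp
    finally show ?thesis .
  qed
  have "(\<Sum>k\<in>?G. ?B k z * (\<Sum>x\<in>cube n. \<Sum>z\<in>cube n. ?B k z * A x z)) =
      (\<Sum>k\<in>?G. of_bool (z = k) * (2 / 2 ^ n * (\<Sum>x\<in>cube n. A x k)))"
    by (intro sum.cong refl) (simp only: ip, simp)
  also have "\<dots> = of_bool (wt z \<le> m) * (2 / 2 ^ n * (\<Sum>x\<in>cube n. A x z))"
    using \<open>z \<in> cube n\<close> by (subst sum_mult_of_bool_eq(2)) simp_all
  finally show "A x z - (\<Sum>k\<in>?G. ?B k z * (\<Sum>x\<in>cube n. \<Sum>z\<in>cube n. ?B k z * A x z)) =
      A x z - of_bool (wt z \<le> m) * (2 / 2 ^ n * (\<Sum>x\<in>cube n. A x z))"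
    by simp
qed

section \<open>The search algorithm\<close>

definition init_label :: "nat \<Rightarrow> label" where
  "init_label n = (replicate n False, False, replicate n False)"

text \<open>Measurement outcomes are bit strings, so a full measurement in the label basis needs an
  encoding that is injective on labels.\<close>

definition encode :: "label \<Rightarrow> bool list" where
  "encode = (\<lambda>(x, a, z). x @ [a] @ z)"

definition decode :: "nat \<Rightarrow> bool list \<Rightarrow> label" where
  "decode n k = (take n k, k ! n, drop (Suc n) k)"

text \<open>The images under \<open>readout_op\<close> of the unit vectors that span the good
  subspace.\<close>

definition good_labels :: "nat \<Rightarrow> nat \<Rightarrow> label set" where
  "good_labels n m = {(replicate n False, False, z) | z. z \<in> cube n \<and> wt z \<le> m}"

text \<open>The second XOR undoes the first, so phase-state amplitudes are multiplied by
  \<open>f x * g (xor_list x z)\<close> at one query to each function.\<close>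

definition query_both :: "qalg \<Rightarrow> qalg" where
  "query_both A = Query_f None (Apply (perm_op xor_map) (Query_g None (Apply (perm_op xor_map) A)))"

text \<open>If D is the sign operator of \<open>query_both\<close> and u the uniform vector, then
  \<open>\<phi>\<close> is D u, so conjugating the reflection in u by D gives the reflection that
  negates \<open>\<phi>\<close>. The global sign of the usual Grover operator is left out and
  reappears as \<open>pi\<close> in the angle.\<close>

definition grover_step :: "nat \<Rightarrow> nat \<Rightarrow> qalg \<Rightarrow> qalg" where
  "grover_step n m A =
     Apply (refl_good_op n m) (query_both (Apply (refl_uniform_op n) (query_both A)))"

text \<open>A bad outcome leaves a known basis vector, which the transposition returns to the
  initial label. As \<open>valid_qalg\<close> ranges over all strings \<open>k\<close>, those that
  decode to no label get their own branch.\<close>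

definition measure_or_restart :: "nat \<Rightarrow> nat \<Rightarrow> qalg \<Rightarrow> qalg" where
  "measure_or_restart n m A = Measure encode (\<lambda>k.
     let b = decode n k in
     if b \<in> good_labels n m then Halt (Some (snd (snd b)))
     else if b \<in> labels n n then Apply (perm_op (Transposition.transpose (init_label n) b)) A
     else Halt None)"

definition attempt :: "nat \<Rightarrow> nat \<Rightarrow> nat \<Rightarrow> qalg \<Rightarrow> qalg" where
  "attempt n m j A = Apply (prep_op n) (query_both
     ((grover_step n m ^^ j) (Apply (readout_op n) (measure_or_restart n m A))))"

text \<open>
  The \<open>j\<close> Grover steps of stage \<open>t\<close> are chosen such that \<open>2 * j + 1 = 3 ^ t\<close>, which is both the
  factor multiplying the angle and the number of queries to each function.
\<close>

primrec search :: "nat \<Rightarrow> nat \<Rightarrow> nat \<Rightarrow> nat \<Rightarrow> qalg" where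
  "search n m 0 t = Halt None"
| "search n m (Suc d) t = attempt n m ((3 ^ t - 1) div 2) (search n m d (Suc t))"

section \<open>Validity of the search and the law of its measurements\<close>

lemma decode_encode: "b \<in> labels n n \<Longrightarrow> decode n (encode b) = b"
  by (auto simp: labels_def cube_def encode_def decode_def)

lemma init_label: "init_label n \<in> labels n n"
  by (simp add: init_label_def labels_def replicate_cube)

lemma init_state_eq: "init_state n n = (\<lambda>b. of_bool (b = init_label n))"
  by (simp add: init_state_def init_label_def)

lemma transpose_labels:
  "b \<in> labels n n \<Longrightarrow> c \<in> labels n n \<Longrightarrow>
    Transposition.transpose (init_label n) b c \<in> labels n n \<and>
    Transposition.transpose (init_label n) b (Transposition.transpose (init_label n) b c) = c"
  using init_label by (auto simp: Transposition.transpose_def)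

lemma valid_attempt:
  assumes "valid_qalg n n A"
  shows "valid_qalg n n (attempt n m j A)"
proof -
  have "valid_qalg n n ((grover_step n m ^^ j) B)" if "valid_qalg n n B" for B
    using that by (induction j)
      (simp_all add: grover_step_def query_both_def unitary_refl_good_op unitary_refl_uniform_op
        unitary_xor_op)
  then show ?thesis
    using assms transpose_labels
    by (simp add: attempt_def query_both_def measure_or_restart_def unitary_prep_op unitary_xor_op
        unitary_readout_op Let_def unitary_perm_op)
qed

lemma valid_search: "valid_qalg n n (search n m d t)"
  by (induction d arbitrary: t) (simp_all add: valid_attempt)

text \<open>An outcome determines its label, so the state collapses to a multiple of one basis
  vector and \<open>run_prob_cmult\<close> takes out the probability.\<close>

lemma run_measure_or_restart:
  "run_prob n n f g (measure_or_restart n m A) (apply_op n n U \<psi>) E =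
    (\<Sum>b\<in>labels n n. (cmod (apply_op n n U \<psi> b))\<^sup>2 *
      (if b \<in> good_labels n m then of_bool (E (Some (snd (snd b))) 0 0)
       else run_prob n n f g A (init_state n n) E))"
proof -
  let ?L = "labels n n" and ?\<phi> = "apply_op n n U \<psi>"
  let ?K = "\<lambda>k. let b = decode n k in
     if b \<in> good_labels n m then Halt (Some (snd (snd b)))
     else if b \<in> ?L then Apply (perm_op (Transposition.transpose (init_label n) b)) A
     else Halt None"
  have inj: "inj_on encode ?L"
    using decode_encode by (rule inj_on_inverseI)
  \<comment> \<open>Being an output of \<open>apply_op\<close>, the state vanishes outside the
    labels, where \<open>encode\<close> need not be injective.\<close>
  have proj: "(\<lambda>c. if encode c = encode b then ?\<phi> c else 0) = (\<lambda>c. ?\<phi> b * of_bool (c = b))"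
    if "b \<in> ?L" for b
  proof
    fix c
    show "(if encode c = encode b then ?\<phi> c else 0) = ?\<phi> b * of_bool (c = b)"
      using inj_onD[OF inj, of c b] that by (cases "c \<in> ?L") (auto simp: apply_op_def)
  qed
  have basis: "run_prob n n f g (?K (encode b)) (\<lambda>c. of_bool (c = b)) E =
      (if b \<in> good_labels n m then of_bool (E (Some (snd (snd b))) 0 0)
       else run_prob n n f g A (init_state n n) E)" if "b \<in> ?L" for b
  proof (cases "b \<in> good_labels n m")
    case True
    have "normsq n n (\<lambda>c. of_bool (c = b)) = (\<Sum>c\<in>?L. if c = b then 1 else 0)"
      unfolding normsq_def by (intro sum.cong refl) simp
    then have "normsq n n (\<lambda>c. of_bool (c = b)) = 1"
      using that by (simp add: sum.delta')
    then show ?thesis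
      using True that by (simp add: decode_encode)
  next
    case False
    have "apply_op n n (perm_op (Transposition.transpose (init_label n) b)) (\<lambda>c. of_bool (c = b)) =
        (\<lambda>c. if c \<in> ?L then of_bool (Transposition.transpose (init_label n) b c = b) else 0)"
      using transpose_labels[OF that] by (rule apply_perm_op)
    also have "\<dots> = init_state n n"
      using that init_label[of n] by (auto simp: init_state_eq Transposition.transpose_def fun_eq_iff)
    finally show ?thesis
      using False that by (simp add: decode_encode)
  qed
  have "run_prob n n f g (measure_or_restart n m A) ?\<phi> E =
      (\<Sum>b\<in>?L. run_prob n n f g (?K (encode b)) (\<lambda>c. if encode c = encode b then ?\<phi> c else 0) E)"
    unfolding measure_or_restart_def run_prob.simps using inj by (subst sum.reindex) simp_all
  also have "\<dots> = (\<Sum>b\<in>?L. (cmod (?\<phi> b))\<^sup>2 *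
      run_prob n n f g (?K (encode b)) (\<lambda>c. of_bool (c = b)) E)"
    by (intro sum.cong refl) (simp only: proj run_prob_cmult)
  finally show ?thesis
    by (simp only: basis cong: sum.cong)
qed

definition shift_queries ::
  "nat \<Rightarrow> (bool list option \<Rightarrow> nat \<Rightarrow> nat \<Rightarrow> bool) \<Rightarrow> bool list option \<Rightarrow> nat \<Rightarrow> nat \<Rightarrow> bool" where
  "shift_queries k E = (\<lambda>v p q. E v (p + k) (q + k))"

lemma shift_queries_shift: "shift_queries j (shift_queries k E) = shift_queries (j + k) E"
  by (simp add: shift_queries_def add.assoc)

section \<open>Amplitude amplification for a pair of oracles\<close>

locale oracle_pair =
  fixes n m :: nat and f g :: "bool list \<Rightarrow> int"
  assumes f: "f \<in> cube n \<rightarrow> {1, -1}" and g: "g \<in> cube n \<rightarrow> {1, -1}"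
begin

abbreviation run where "run \<equiv> run_prob n n f g"
abbreviation C where "C \<equiv> cross_corr n f g"
abbreviation a where "a \<equiv> corr_amp n m f g"

definition corr_sign :: "bool list \<Rightarrow> bool list \<Rightarrow> real" where
  "corr_sign x z = real_of_int (f x * g (xor_list x z))"

lemma corr_sign_square: "x \<in> cube n \<Longrightarrow> z \<in> cube n \<Longrightarrow> corr_sign x z * corr_sign x z = 1"
proof -
  assume "x \<in> cube n" "z \<in> cube n"
  then have "f x \<in> {1, -1}" "g (xor_list x z) \<in> {1, -1}"
    using f g xor_list_cube by blast+
  then show ?thesis by (auto simp: corr_sign_def)
qed

lemma sum_corr_sign: "(\<Sum>x\<in>cube n. corr_sign x z) = real_of_int (C z)"
  by (simp add: corr_sign_def cross_corr_def)

lemma run_query_both: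
  "run (query_both A) (phase_state n B) E =
    run A (phase_state n (\<lambda>x z. corr_sign x z * B x z)) (shift_queries 1 E)"
proof -
  have "phase_state n (\<lambda>x z. real_of_int (g (xor_list x z)) *
      (real_of_int (f (xor_list (xor_list x z) z)) * B (xor_list (xor_list x z) z) z))
      = phase_state n (\<lambda>x z. corr_sign x z * B x z)"
    by (rule phase_state_cong) (simp add: xor_list_cancel corr_sign_def)
  then show ?thesis
    by (simp add: query_both_def apply_oracle_phase_state[OF f] apply_oracle_phase_state[OF g]
        apply_xor_phase_state shift_queries_def)
qed

text \<open>
  The span of \<open>\<phi> = corr_sign / 2 ^ n\<close> and of its projection \<open>\<rho>\<close> onto the good subspace.  The parameters
  are the coordinates of the state relative to \<open>\<phi> - \<rho>\<close> and \<open>\<rho>\<close>.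
\<close>

definition grover_vec :: "real \<Rightarrow> real \<Rightarrow> bool list \<Rightarrow> bool list \<Rightarrow> real" where
  "grover_vec \<alpha> \<gamma> x z =
     \<alpha> * (corr_sign x z / 2 ^ n) + (\<gamma> - \<alpha>) * (of_bool (wt z \<le> m) * real_of_int (C z) / 4 ^ n)"

lemma corr_amp_square:
  "a\<^sup>2 = (\<Sum>z\<in>cube n. of_bool (wt z \<le> m) * (real_of_int (C z))\<^sup>2) / 8 ^ n"
proof -
  have "(\<Sum>z\<in>{z\<in>cube n. wt z \<le> m}. (real_of_int (C z))\<^sup>2) =
      (\<Sum>z\<in>cube n. of_bool (wt z \<le> m) * (real_of_int (C z))\<^sup>2)"
    by (rule sum.mono_neutral_cong_left) auto
  moreover have "(2::real) ^ (3 * n) = 8 ^ n"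
    by (simp add: power_mult)
  ultimately show ?thesis
    by (simp add: corr_amp_def sum_nonneg)
qed

lemma corr_amp_nonneg: "a \<ge> 0"
  by (simp add: corr_amp_def sum_nonneg)

text \<open>A column of \<open>\<phi>\<close> sums to \<open>C z / 2 ^ n\<close>, and in columns of
  weight at most \<open>m\<close> so does \<open>\<rho>\<close>; there the \<open>\<alpha>\<close>
  terms cancel.\<close>

lemma sum_grover_vec:
  "(\<Sum>x\<in>cube n. grover_vec \<alpha> \<gamma> x z) =
    (if wt z \<le> m then \<gamma> else \<alpha>) * real_of_int (C z) / 2 ^ n"
proof -
  have "(\<Sum>x\<in>cube n. grover_vec \<alpha> \<gamma> x z) = \<alpha> * (real_of_int (C z) / 2 ^ n) +
      2 ^ n * ((\<gamma> - \<alpha>) * (of_bool (wt z \<le> m) * real_of_int (C z) / 4 ^ n))"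
    by (simp add: grover_vec_def sum.distrib card_cube sum_corr_sign flip: sum_distrib_left
        sum_divide_distrib)
  moreover have "(4::real) ^ n = 2 ^ n * 2 ^ n"
    by (simp flip: power_mult_distrib)
  ultimately show ?thesis
    by (cases "wt z \<le> m") (simp_all add: field_simps)
qed

text \<open>This is \<open>2 ^ n\<close> times the inner product with \<open>\<phi>\<close>, to
  which \<open>\<phi> - \<rho>\<close> contributes \<open>1 - a\<^sup>2\<close> and
  \<open>\<rho>\<close> contributes \<open>a\<^sup>2\<close>.\<close>

lemma sum_corr_sign_grover_vec:
  "(\<Sum>x\<in>cube n. \<Sum>z\<in>cube n. corr_sign x z * grover_vec \<alpha> \<gamma> x z) = 2 ^ n * (\<alpha> + (\<gamma> - \<alpha>) * a\<^sup>2)"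
proof -
  have "(\<Sum>x\<in>cube n. \<Sum>z\<in>cube n. corr_sign x z * grover_vec \<alpha> \<gamma> x z) =
      (\<Sum>x\<in>cube n. \<Sum>z\<in>cube n. \<alpha> / 2 ^ n +
        (\<gamma> - \<alpha>) / 4 ^ n * (corr_sign x z * (of_bool (wt z \<le> m) * real_of_int (C z))))"
  proof (intro sum.cong refl)
    fix x z assume "x \<in> cube n" "z \<in> cube n"
    then have "corr_sign x z * grover_vec \<alpha> \<gamma> x z = \<alpha> * (corr_sign x z * corr_sign x z) / 2 ^ n +
        (\<gamma> - \<alpha>) / 4 ^ n * (corr_sign x z * (of_bool (wt z \<le> m) * real_of_int (C z)))"
      by (simp add: grover_vec_def algebra_simps)
    then show "corr_sign x z * grover_vec \<alpha> \<gamma> x z = \<alpha> / 2 ^ n +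
        (\<gamma> - \<alpha>) / 4 ^ n * (corr_sign x z * (of_bool (wt z \<le> m) * real_of_int (C z)))"
      using corr_sign_square[OF \<open>x \<in> cube n\<close> \<open>z \<in> cube n\<close>] by simp
  qed
  also have "\<dots> = 2 ^ n * \<alpha> + (\<gamma> - \<alpha>) / 4 ^ n *
      (\<Sum>x\<in>cube n. \<Sum>z\<in>cube n. corr_sign x z * (of_bool (wt z \<le> m) * real_of_int (C z)))"
    by (simp add: sum.distrib card_cube sum_distrib_left)
  \<comment> \<open>Summing over \<open>x\<close> first turns \<open>corr_sign\<close> into
    \<open>C z\<close>, which completes the square in \<open>a\<^sup>2\<close>.\<close>
  also have "(\<Sum>x\<in>cube n. \<Sum>z\<in>cube n. corr_sign x z * (of_bool (wt z \<le> m) * real_of_int (C z))) =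
      (\<Sum>z\<in>cube n. real_of_int (C z) * (of_bool (wt z \<le> m) * real_of_int (C z)))"
    by (subst sum.swap) (simp only: sum_corr_sign sum_distrib_right[symmetric])
  also have "\<dots> = 8 ^ n * a\<^sup>2"
    unfolding corr_amp_square by (simp add: power2_eq_square algebra_simps)
  also have "2 ^ n * \<alpha> + (\<gamma> - \<alpha>) / 4 ^ n * (8 ^ n * a\<^sup>2) = 2 ^ n * (\<alpha> + (\<gamma> - \<alpha>) * a\<^sup>2)"
  proof -
    have "(8::real) ^ n = 4 ^ n * 2 ^ n"
      by (simp flip: power_mult_distrib)
    then show ?thesis by (simp add: field_simps)
  qed
  finally show ?thesis .
qed

text \<open>The good reflection negates \<open>\<gamma>\<close>. The reflection in
  \<open>\<phi>\<close>, whose coordinates are \<open>(1, 1)\<close>, then subtracts twice the inner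
  product \<open>\<alpha> - (\<alpha> + \<gamma>) * a\<^sup>2\<close> from both coordinates.\<close>

lemma run_grover_step:
  "run (grover_step n m A) (phase_state n (grover_vec \<alpha> \<gamma>)) E =
    run A (phase_state n (grover_vec (2 * (\<alpha> + \<gamma>) * a\<^sup>2 - \<alpha>) (2 * (\<alpha> + \<gamma>) * a\<^sup>2 - 2 * \<alpha> - \<gamma>)))
      (shift_queries 2 E)"
proof -
  let ?S = "2 ^ n * (\<alpha> + (- \<gamma> - \<alpha>) * a\<^sup>2)"
  have "phase_state n (\<lambda>x z. grover_vec \<alpha> \<gamma> x z -
      of_bool (wt z \<le> m) * (2 / 2 ^ n * (\<Sum>x\<in>cube n. grover_vec \<alpha> \<gamma> x z)))
      = phase_state n (grover_vec \<alpha> (- \<gamma>))"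
  proof (rule phase_state_cong)
    fix x z assume "x \<in> cube n" "z \<in> cube n"
    moreover have "(4::real) ^ n = 2 ^ n * 2 ^ n"
      by (simp flip: power_mult_distrib)
    ultimately show "grover_vec \<alpha> \<gamma> x z -
      of_bool (wt z \<le> m) * (2 / 2 ^ n * (\<Sum>x\<in>cube n. grover_vec \<alpha> \<gamma> x z)) = grover_vec \<alpha> (- \<gamma>) x z"
      by (simp add: sum_grover_vec) (simp add: grover_vec_def field_simps)
  qed
  moreover have "phase_state n (\<lambda>x z. corr_sign x z * (corr_sign x z * grover_vec \<alpha> (- \<gamma>) x z - 2 / 4 ^ n * ?S))
      = phase_state n (grover_vec (2 * (\<alpha> + \<gamma>) * a\<^sup>2 - \<alpha>) (2 * (\<alpha> + \<gamma>) * a\<^sup>2 - 2 * \<alpha> - \<gamma>))"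
  proof (rule phase_state_cong)
    fix x z assume xz: "x \<in> cube n" "z \<in> cube n"
    have "corr_sign x z * (corr_sign x z * grover_vec \<alpha> (- \<gamma>) x z - 2 / 4 ^ n * ?S) =
        (corr_sign x z * corr_sign x z) * grover_vec \<alpha> (- \<gamma>) x z - corr_sign x z * (2 / 4 ^ n * ?S)"
      by (simp add: algebra_simps)
    also have "\<dots> = grover_vec \<alpha> (- \<gamma>) x z - corr_sign x z * (2 / 4 ^ n * ?S)"
      using corr_sign_square[OF xz] by simp
    finally have eq: "corr_sign x z * (corr_sign x z * grover_vec \<alpha> (- \<gamma>) x z - 2 / 4 ^ n * ?S) =
        grover_vec \<alpha> (- \<gamma>) x z - corr_sign x z * (2 / 4 ^ n * ?S)" .
    have "(4::real) ^ n = 2 ^ n * 2 ^ n"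
      by (simp flip: power_mult_distrib)
    then show "corr_sign x z * (corr_sign x z * grover_vec \<alpha> (- \<gamma>) x z - 2 / 4 ^ n * ?S) =
        grover_vec (2 * (\<alpha> + \<gamma>) * a\<^sup>2 - \<alpha>) (2 * (\<alpha> + \<gamma>) * a\<^sup>2 - 2 * \<alpha> - \<gamma>) x z"
      unfolding eq by (simp add: grover_vec_def field_simps)
  qed
  ultimately show ?thesis
    by (simp add: grover_step_def apply_refl_good_op apply_refl_uniform_op run_query_both
        sum_corr_sign_grover_vec shift_queries_shift numeral_2_eq_2[symmetric])
qed

section \<open>Rotation angle and the outcome of one attempt\<close>

abbreviation \<theta> where "\<theta> \<equiv> arcsin a"

text \<open>Each \<open>C z\<close> is a sum of \<open>2 ^ n\<close> signs, so the squares add up to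
  at most \<open>2 ^ n * 4 ^ n = 8 ^ n\<close>. Hence \<open>arcsin a\<close> is an angle with sine
  \<open>a\<close>.\<close>

lemma corr_amp_le_1: "a \<le> 1"
proof -
  have C_le: "(real_of_int (C z))\<^sup>2 \<le> 4 ^ n" if "z \<in> cube n" for z
  proof -
    have "\<bar>corr_sign x z\<bar> = 1" if "x \<in> cube n" for x
      using corr_sign_square[OF that \<open>z \<in> cube n\<close>]
      by (metis abs_mult_self_eq abs_one abs_square_eq_1 power2_eq_square)
    then have "\<bar>real_of_int (C z)\<bar> \<le> 2 ^ n"
      unfolding sum_corr_sign[symmetric]
      using sum_abs[of "\<lambda>x. corr_sign x z" "cube n"] by (simp add: card_cube)
    then have "\<bar>real_of_int (C z)\<bar>\<^sup>2 \<le> (2 ^ n)\<^sup>2"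
      by (intro power_mono) auto
    also have "(2 ^ n)\<^sup>2 = (4::real) ^ n"
      by (simp add: power2_eq_square flip: power_mult_distrib)
    finally show ?thesis by simp
  qed
  have "(\<Sum>z\<in>cube n. of_bool (wt z \<le> m) * (real_of_int (C z))\<^sup>2) \<le> (\<Sum>z\<in>cube n. 4 ^ n)"
    by (intro sum_mono) (auto simp: C_le)
  also have "\<dots> = 8 ^ n"
    by (simp add: card_cube flip: power_mult_distrib)
  finally have "a\<^sup>2 \<le> 1"
    by (simp add: corr_amp_square)
  then show ?thesis
    using power2_le_imp_le[of a 1] by simp
qed

lemma theta: "sin \<theta> = a" "0 \<le> \<theta>" "\<theta> \<le> pi / 2"
  using corr_amp_nonneg corr_amp_le_1 arcsin_le_arcsin[of 0 a] arcsin_bounded[of a] by auto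

text \<open>\<open>\<phi> - \<rho>\<close> and \<open>\<rho>\<close> have norms
  \<open>cos \<theta>\<close> and \<open>sin \<theta>\<close>, so the normalized coordinates are the
  cosine and sine of an angle that grows by \<open>2 * \<theta> + pi\<close> per step. Products
  instead of quotients cover the cases where one of the two vectors is zero.\<close>

lemma run_grover_steps:
  assumes "cos \<theta> * \<alpha> = cos \<Theta>" and "sin \<theta> * \<gamma> = sin \<Theta>"
  shows "\<exists>\<alpha>' \<gamma>'. cos \<theta> * \<alpha>' = cos (\<Theta> + j * (2 * \<theta> + pi)) \<and>
    sin \<theta> * \<gamma>' = sin (\<Theta> + j * (2 * \<theta> + pi)) \<and>
    (\<forall>A E. run ((grover_step n m ^^ j) A) (phase_state n (grover_vec \<alpha> \<gamma>)) E =
      run A (phase_state n (grover_vec \<alpha>' \<gamma>')) (shift_queries (2 * j) E))"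
  using assms
proof (induction j arbitrary: \<alpha> \<gamma> \<Theta>)
  case 0
  then show ?case by (auto simp: shift_queries_def)
next
  case (Suc j)
  let ?\<alpha> = "2 * (\<alpha> + \<gamma>) * a\<^sup>2 - \<alpha>" and ?\<gamma> = "2 * (\<alpha> + \<gamma>) * a\<^sup>2 - 2 * \<alpha> - \<gamma>"
  have "cos \<theta> * ?\<alpha> = 2 * (sin \<theta>)\<^sup>2 * (cos \<theta> * \<alpha>) + 2 * sin \<theta> * cos \<theta> * (sin \<theta> * \<gamma>) - cos \<theta> * \<alpha>"
    by (simp add: theta(1) power2_eq_square algebra_simps)
  also have "\<dots> = cos (\<Theta> + (2 * \<theta> + pi))"
    unfolding Suc.prems by (simp add: cos_add sin_add cos_double_sin sin_double algebra_simps)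
  finally have c: "cos \<theta> * ?\<alpha> = cos (\<Theta> + (2 * \<theta> + pi))" .
  have "sin \<theta> * ?\<gamma> = 2 * (sin \<theta>)\<^sup>2 * (sin \<theta> * \<gamma>) - sin \<theta> * \<gamma> - 2 * sin \<theta> * (1 - (sin \<theta>)\<^sup>2) * \<alpha>"
    by (simp add: theta(1) power2_eq_square algebra_simps)
  also have "\<dots> = 2 * (sin \<theta>)\<^sup>2 * (sin \<theta> * \<gamma>) - sin \<theta> * \<gamma> - 2 * sin \<theta> * cos \<theta> * (cos \<theta> * \<alpha>)"
    by (simp only: cos_squared_eq[symmetric]) (simp add: power2_eq_square)
  also have "\<dots> = sin (\<Theta> + (2 * \<theta> + pi))"
    unfolding Suc.prems by (simp add: cos_add sin_add cos_double_sin sin_double algebra_simps)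
  finally have s: "sin \<theta> * ?\<gamma> = sin (\<Theta> + (2 * \<theta> + pi))" .
  have angle: "\<Theta> + (2 * \<theta> + pi) + real j * (2 * \<theta> + pi) = \<Theta> + real (Suc j) * (2 * \<theta> + pi)"
    by (simp add: algebra_simps)
  obtain \<alpha>' \<gamma>' where "cos \<theta> * \<alpha>' = cos (\<Theta> + real (Suc j) * (2 * \<theta> + pi))"
    and "sin \<theta> * \<gamma>' = sin (\<Theta> + real (Suc j) * (2 * \<theta> + pi))"
    and steps: "\<And>A E. run ((grover_step n m ^^ j) A) (phase_state n (grover_vec ?\<alpha> ?\<gamma>)) E =
      run A (phase_state n (grover_vec \<alpha>' \<gamma>')) (shift_queries (2 * j) E)"
    using Suc.IH[OF c s] unfolding angle by blast
  moreover have "run ((grover_step n m ^^ Suc j) A) (phase_state n (grover_vec \<alpha> \<gamma>)) E =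
      run A (phase_state n (grover_vec \<alpha>' \<gamma>')) (shift_queries (2 * Suc j) E)" for A E
    by (simp only: funpow.simps comp_apply run_grover_step steps shift_queries_shift)
      (simp add: add.commute)
  ultimately show ?case by blast
qed

lemma run_attempt:
  obtains \<psi> \<gamma> where
    "(sin \<theta> * \<gamma>)\<^sup>2 = (sin (real (2 * j + 1) * \<theta>))\<^sup>2"
    "normsq n n \<psi> = 1"
    "\<And>z. z \<in> cube n \<Longrightarrow> wt z \<le> m \<Longrightarrow>
      (cmod (\<psi> (replicate n False, False, z)))\<^sup>2 = \<gamma>\<^sup>2 * (real_of_int (C z))\<^sup>2 / 8 ^ n"
    "\<And>A E. run (attempt n m j A) (init_state n n) E =
      (\<Sum>b\<in>labels n n. (cmod (\<psi> b))\<^sup>2 *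
        (if b \<in> good_labels n m then of_bool (E (Some (snd (snd b))) (2 * j + 1) (2 * j + 1))
         else run A (init_state n n) (shift_queries (2 * j + 1) E)))"
proof -
  let ?N = "2 * j + 1"
  obtain \<alpha> \<gamma> where sin_\<gamma>: "sin \<theta> * \<gamma> = sin (\<theta> + j * (2 * \<theta> + pi))"
    and steps: "\<And>A E. run ((grover_step n m ^^ j) A) (phase_state n (grover_vec 1 1)) E =
      run A (phase_state n (grover_vec \<alpha> \<gamma>)) (shift_queries (2 * j) E)"
    \<comment> \<open>The starting vector \<open>\<phi>\<close> has coordinates
      \<open>(1, 1)\<close>, hence angle \<open>\<theta>\<close>.\<close>
    using run_grover_steps[of 1 \<theta> 1 j] by auto
  define \<psi> where "\<psi> = apply_op n n (readout_op n) (phase_state n (grover_vec \<alpha> \<gamma>))"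
  have start: "phase_state n (\<lambda>x z. corr_sign x z * (1 / 2 ^ n)) = phase_state n (grover_vec 1 1)"
    by (rule phase_state_cong) (simp add: grover_vec_def)
  have run: "run (attempt n m j A) (init_state n n) E =
      run (measure_or_restart n m A) \<psi> (shift_queries ?N E)" for A E
    unfolding attempt_def run_prob.simps apply_prep_op run_query_both start steps
      \<psi>_def[symmetric] shift_queries_shift by simp
  show thesis
  proof
    have "\<theta> + real j * (2 * \<theta> + pi) = real ?N * \<theta> + real j * pi"
      by (simp add: algebra_simps)
    \<comment> \<open>The multiples of \<open>pi\<close> leave only a sign, which squaring
      removes.\<close>
    then have "sin (\<theta> + real j * (2 * \<theta> + pi)) = sin (real ?N * \<theta>) * (-1) ^ j"
      by (simp add: sin_add cos_npi sin_npi)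
    then show "(sin \<theta> * \<gamma>)\<^sup>2 = (sin (real ?N * \<theta>))\<^sup>2"
      unfolding sin_\<gamma> by (simp only: power_mult_distrib) (simp flip: power_mult)
    show "normsq n n \<psi> = 1"
    proof -
      \<comment> \<open>The norm is obtained from conservation of total probability, applied to an
        attempt that is followed by \<open>Halt None\<close>.\<close>
      have "normsq n n (init_state n n) = run (attempt n m j (Halt None)) (init_state n n) (\<lambda>_ _ _. True)"
        by (rule run_prob_total[symmetric]) (simp add: valid_attempt)
      also have "\<dots> = run (measure_or_restart n m (Halt None)) \<psi> (\<lambda>_ _ _. True)"
        unfolding run by (simp add: shift_queries_def)
      also have "\<dots> = normsq n n \<psi>"
        using transpose_labels
        by (intro run_prob_total) (simp add: measure_or_restart_def Let_def unitary_perm_op)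
      finally show ?thesis by (simp add: normsq_init_state)
    qed
    show "(cmod (\<psi> (replicate n False, False, z)))\<^sup>2 = \<gamma>\<^sup>2 * (real_of_int (C z))\<^sup>2 / 8 ^ n"
      if "z \<in> cube n" "wt z \<le> m" for z
    proof -
      have "\<psi> (replicate n False, False, z) =
          complex_of_real (\<gamma> * real_of_int (C z) / 2 ^ n / sqrt (2 ^ n))"
        unfolding \<psi>_def using that by (simp add: apply_readout_op sum_grover_vec)
      then have "(cmod (\<psi> (replicate n False, False, z)))\<^sup>2 =
          (\<gamma> * real_of_int (C z) / 2 ^ n / sqrt (2 ^ n))\<^sup>2"
        by (simp only: norm_of_real power2_abs)
      also have "\<dots> = \<gamma>\<^sup>2 * (real_of_int (C z))\<^sup>2 / (2 ^ n * 2 ^ n * 2 ^ n)"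
        unfolding power_divide power_mult_distrib power2_eq_square[of "2 ^ n"] by simp
      also have "(2::real) ^ n * 2 ^ n * 2 ^ n = 8 ^ n"
        by (simp flip: power_mult_distrib)
      finally show ?thesis .
    qed
    show "run (attempt n m j A) (init_state n n) E =
      (\<Sum>b\<in>labels n n. (cmod (\<psi> b))\<^sup>2 *
        (if b \<in> good_labels n m then of_bool (E (Some (snd (snd b))) ?N ?N)
         else run A (init_state n n) (shift_queries ?N E)))" for A E
      unfolding run \<psi>_def run_measure_or_restart by (simp add: shift_queries_def cong: if_cong)
  qed
qed

section \<open>Success probability and query count of the search\<close>

lemma sum_good_labels:
  "(\<Sum>b\<in>good_labels n m. F b) = (\<Sum>z\<in>{z\<in>cube n. wt z \<le> m}. F (replicate n False, False, z))"
  by (rule sum.reindex_bij_witness[of _ "\<lambda>z. (replicate n False, False, z)" "\<lambda>b. snd (snd b)"])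
     (auto simp: good_labels_def)

lemma good_labels_subset: "good_labels n m \<subseteq> labels n n"
  by (auto simp: good_labels_def labels_def replicate_cube)

text \<open>Only good labels lead to a report, and in every attempt their amplitudes are multiples
  of values \<open>C z\<close> that vanish.\<close>

lemma run_search_uncorrelated:
  assumes "uncorrelated n m f g"
  shows "run (search n m d t) (init_state n n) (\<lambda>v p q. v \<noteq> None) = 0"
proof (induction d arbitrary: t)
  case (Suc d)
  let ?j = "(3 ^ t - 1) div 2 :: nat"
  obtain \<psi> \<gamma> where good: "\<And>z. z \<in> cube n \<Longrightarrow> wt z \<le> m \<Longrightarrow>
      (cmod (\<psi> (replicate n False, False, z)))\<^sup>2 = \<gamma>\<^sup>2 * (real_of_int (C z))\<^sup>2 / 8 ^ n"
    and run: "\<And>A E. run (attempt n m ?j A) (init_state n n) E =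
      (\<Sum>b\<in>labels n n. (cmod (\<psi> b))\<^sup>2 *
        (if b \<in> good_labels n m then of_bool (E (Some (snd (snd b))) (2 * ?j + 1) (2 * ?j + 1))
         else run A (init_state n n) (shift_queries (2 * ?j + 1) E)))"
    by (rule run_attempt[of ?j]) blast
  have "\<psi> b = 0" if "b \<in> good_labels n m" for b
    using that good assms by (auto simp: good_labels_def uncorrelated_def)
  then show ?case
    unfolding search.simps run shift_queries_def Suc.IH by (intro sum.neutral) simp
qed simp

text \<open>The budget is real, so after \<open>N\<close> queries to each function the remaining
  event is the one for \<open>B - N\<close>.\<close>

definition witness_within :: "real \<Rightarrow> bool list option \<Rightarrow> nat \<Rightarrow> nat \<Rightarrow> bool" where
  "witness_within B v p q \<longleftrightarrow>
    (\<exists>u\<in>cube n. v = Some u \<and> wt u \<le> m \<and> C u \<noteq> 0) \<and> real p \<le> B \<and> real q \<le> B"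

text \<open>The good outcomes have total probability \<open>\<gamma>\<^sup>2 * a\<^sup>2\<close>,
  the squared sine; any other outcome restarts with the reduced budget.\<close>

lemma run_attempt_witness_within:
  assumes N: "N = 2 * j + 1" "real N \<le> B"
  shows "run (attempt n m j A) (init_state n n) (witness_within B) =
    (sin (N * \<theta>))\<^sup>2 + (1 - (sin (N * \<theta>))\<^sup>2) * run A (init_state n n) (witness_within (B - N))"
proof -
  obtain \<psi> \<gamma> where sin_\<gamma>: "(sin \<theta> * \<gamma>)\<^sup>2 = (sin (real N * \<theta>))\<^sup>2"
    and norm: "normsq n n \<psi> = 1"
    and good: "\<And>z. z \<in> cube n \<Longrightarrow> wt z \<le> m \<Longrightarrow>
      (cmod (\<psi> (replicate n False, False, z)))\<^sup>2 = \<gamma>\<^sup>2 * (real_of_int (C z))\<^sup>2 / 8 ^ n"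
    and run: "\<And>A E. run (attempt n m j A) (init_state n n) E =
      (\<Sum>b\<in>labels n n. (cmod (\<psi> b))\<^sup>2 *
        (if b \<in> good_labels n m then of_bool (E (Some (snd (snd b))) N N)
         else run A (init_state n n) (shift_queries N E)))"
    unfolding N(1) by (rule run_attempt[of j]) blast
  let ?G = "good_labels n m" and ?r = "run A (init_state n n) (witness_within (B - N))"
  have shift: "shift_queries N (witness_within B) = witness_within (B - N)"
    by (auto simp: shift_queries_def witness_within_def fun_eq_iff)
  \<comment> \<open>A good label with \<open>C z = 0\<close> is no witness, but its amplitude is
    zero, so the equation still holds.\<close>
  have hit: "(cmod (\<psi> b))\<^sup>2 * of_bool (witness_within B (Some (snd (snd b))) N N) = (cmod (\<psi> b))\<^sup>2"
    if "b \<in> ?G" for b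
  proof -
    obtain z where z: "b = (replicate n False, False, z)" "z \<in> cube n" "wt z \<le> m"
      using \<open>b \<in> ?G\<close> by (auto simp: good_labels_def)
    show ?thesis
      using good[OF z(2,3)] z N(2) by (cases "C z = 0") (auto simp: witness_within_def)
  qed
  have "(\<Sum>b\<in>?G. (cmod (\<psi> b))\<^sup>2) =
      (\<Sum>z\<in>{z\<in>cube n. wt z \<le> m}. \<gamma>\<^sup>2 * (real_of_int (C z))\<^sup>2 / 8 ^ n)"
    unfolding sum_good_labels by (intro sum.cong refl) (simp add: good)
  also have "\<dots> = (\<Sum>z\<in>cube n. \<gamma>\<^sup>2 / 8 ^ n * (of_bool (wt z \<le> m) * (real_of_int (C z))\<^sup>2))"
    by (rule sum.mono_neutral_cong_left) auto
  also have "\<dots> = (sin \<theta> * \<gamma>)\<^sup>2"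
    unfolding sum_distrib_left[symmetric] theta(1) power_mult_distrib corr_amp_square by simp
  finally have G: "(\<Sum>b\<in>?G. (cmod (\<psi> b))\<^sup>2) = (sin (real N * \<theta>))\<^sup>2"
    unfolding sin_\<gamma> .
  have rest: "(\<Sum>b\<in>labels n n - ?G. (cmod (\<psi> b))\<^sup>2) = 1 - (sin (real N * \<theta>))\<^sup>2"
    using norm unfolding normsq_def
    by (simp add: sum_diff[OF finite_labels good_labels_subset] G)
  have "run (attempt n m j A) (init_state n n) (witness_within B) =
      (\<Sum>b\<in>labels n n - ?G. (cmod (\<psi> b))\<^sup>2 * ?r) + (\<Sum>b\<in>?G. (cmod (\<psi> b))\<^sup>2)"
    unfolding run shift sum.subset_diff[OF good_labels_subset finite_labels]
    by (intro arg_cong2[where f = "(+)"] sum.cong refl) (simp_all add: hit)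
  then show ?thesis
    by (simp add: rest G flip: sum_distrib_right)
qed

text \<open>Stages \<open>t\<close> to \<open>i\<close> cost the geometric sum
  \<open>(3 ^ (i + 1) - 3 ^ t) / 2\<close>. Stage \<open>i\<close>, once reached, succeeds with
  probability at least \<open>1 / 4\<close>, and earlier successes only help, as
  \<open>s + (1 - s) / 4 \<ge> 1 / 4\<close>.\<close>

lemma run_search_witness_within:
  assumes "t \<le> i" "i < t + d" "(3 ^ (i + 1) - 3 ^ t) / 2 \<le> B" "(sin (3 ^ i * \<theta>))\<^sup>2 \<ge> 1 / 4"
  shows "run (search n m d t) (init_state n n) (witness_within B) \<ge> 1 / 4"
  using assms(1-3)
proof (induction d arbitrary: t B)
  case (Suc d)
  define s where "s = (sin (real (3 ^ t) * \<theta>))\<^sup>2"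
  let ?r = "run (search n m d (Suc t)) (init_state n n) (witness_within (B - 3 ^ t))"
  have "odd ((3::nat) ^ t)" by simp
  then have N: "(3::nat) ^ t = 2 * ((3 ^ t - 1) div 2) + 1"
    by (auto elim: oddE)
  have "(3::real) ^ t \<le> 3 ^ i"
    using Suc.prems(1) by (intro power_increasing) auto
  \<comment> \<open>Taken with \<open>x = 3 ^ t\<close> and \<open>y = 3 ^ i\<close>: the budget
    pays for the current stage.\<close>
  moreover have "x \<le> B" if "x \<le> y" "(3 * y - x) / 2 \<le> B" for x y :: real
    using that by simp
  ultimately have B: "real (3 ^ t) \<le> B"
    using Suc.prems(3) by (metis add.commute of_nat_numeral of_nat_power plus_1_eq_Suc power_Suc)
  have run: "run (search n m (Suc d) t) (init_state n n) (witness_within B) = s + (1 - s) * ?r"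
    using run_attempt_witness_within[OF N B] by (simp add: s_def)
  have s: "0 \<le> s" "s \<le> 1"
    by (auto simp: s_def abs_square_le_1)
  show ?case
  proof (cases "t = i")
    case True
    then have "s \<ge> 1 / 4"
      using assms(4) by (simp add: s_def)
    moreover have "(1 - s) * ?r \<ge> 0"
      using s run_prob_nonneg by simp
    ultimately show ?thesis
      unfolding run by linarith
  next
    case False
    then have "?r \<ge> 1 / 4"
      using Suc.prems by (intro Suc.IH) (auto simp: field_simps)
    then have "s + (1 - s) * (1 / 4) \<le> s + (1 - s) * ?r"
      using s by (intro add_left_mono mult_left_mono) auto
    moreover have "1 / 4 \<le> s + (1 - s) * (1 / 4)"
      using s by (simp add: field_simps)
    ultimately show ?thesis
      unfolding run by (rule order_trans[rotated])
  qed
qed simp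

text \<open>A nonzero integer has square at least 1, so one witness forces
  \<open>a\<^sup>2 \<ge> 1 / 8 ^ n\<close>, which is at least \<open>1 / 16 ^ n\<close>. This lets
  the number of stages depend on \<open>n\<close> alone.\<close>

lemma corr_amp_lower_bound:
  assumes "\<not> uncorrelated n m f g"
  shows "1 / 4 ^ n \<le> a"
proof -
  obtain y where y: "y \<in> cube n" "wt y \<le> m" "C y \<noteq> 0"
    using assms by (auto simp: uncorrelated_def)
  have "1 \<le> (C y)\<^sup>2"
    using y(3) by (simp add: int_one_le_iff_zero_less)
  then have "(1::real) \<le> (real_of_int (C y))\<^sup>2"
    by (metis of_int_1_le_iff of_int_power)
  also have "\<dots> = of_bool (wt y \<le> m) * (real_of_int (C y))\<^sup>2"
    using y(2) by simp
  also have "\<dots> \<le> (\<Sum>z\<in>cube n. of_bool (wt z \<le> m) * (real_of_int (C z))\<^sup>2)"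
    using y(1) by (intro member_le_sum) auto
  finally have "1 / 8 ^ n \<le> a\<^sup>2"
    unfolding corr_amp_square by (intro divide_right_mono) auto
  moreover have "(1 / 4 ^ n)\<^sup>2 \<le> (1 / 8 ^ n :: real)"
  proof -
    have "(8::real) ^ n \<le> 16 ^ n"
      by (intro power_mono) auto
    then show ?thesis
      by (simp add: power_divide power2_eq_square frac_le flip: power_mult_distrib)
  qed
  ultimately have "(1 / 4 ^ n)\<^sup>2 \<le> a\<^sup>2"
    by linarith
  then show ?thesis
    using corr_amp_nonneg power2_le_imp_le by blast
qed

lemma run_search_correlated:
  assumes "\<not> uncorrelated n m f g"
  shows "run (search n m (2 * n + 2) 0) (init_state n n) (witness_within (3 / a)) \<ge> 1 / 4"
proof -
  have a: "1 / 4 ^ n \<le> a" "a > 0"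
    using corr_amp_lower_bound[OF assms] by (auto intro: less_le_trans[of _ "1 / 4 ^ n"])
  have "\<theta> \<ge> a"
    using sin_x_le_x[of \<theta>] theta by simp
  then have \<theta>: "\<theta> > 0"
    using a by simp
  obtain k where "pi / 2 / \<theta> < 3 ^ k"
    using real_arch_pow[of 3 "pi / 2 / \<theta>"] by auto
  then have ex: "pi / 2 < 3 ^ k * \<theta>"
    using \<theta> by (simp add: field_simps)
  \<comment> \<open>At the first power that overshoots \<open>pi / 2\<close>, the preceding one puts
    \<open>3 ^ i * \<theta>\<close> between \<open>pi / 6\<close> and \<open>pi / 2\<close>, where
    the sine is at least \<open>1 / 2\<close>.\<close>
  define k' where "k' = (LEAST k. pi / 2 < 3 ^ k * \<theta>)"
  have k': "pi / 2 < 3 ^ k' * \<theta>"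
    unfolding k'_def by (rule LeastI) (rule ex)
  have "k' \<noteq> 0"
    using k' theta(3) by (cases k') auto
  then obtain i where i: "k' = Suc i"
    by (cases k') auto
  have upper: "3 ^ i * \<theta> \<le> pi / 2"
    using not_less_Least[of i "\<lambda>k. pi / 2 < 3 ^ k * \<theta>"] i unfolding k'_def by simp
  have "pi / 6 \<le> 3 ^ i * \<theta>"
    using k' unfolding i by simp
  then have "sin (pi / 6) \<le> sin (3 ^ i * \<theta>)"
    using upper by (intro sin_monotone_2pi_le) auto
  then have "(1 / 2)\<^sup>2 \<le> (sin (3 ^ i * \<theta>))\<^sup>2"
    by (intro power_mono) (auto simp: sin_30)
  then have sin: "1 / 4 \<le> (sin (3 ^ i * \<theta>))\<^sup>2"
    by (simp add: power2_eq_square)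
  have "3 ^ i * a \<le> 3 ^ i * \<theta>"
    using \<open>\<theta> \<ge> a\<close> by simp
  \<comment> \<open>This one bound yields both the number of stages and the number of
    queries.\<close>
  then have ia: "3 ^ i * a \<le> 2"
    using upper pi_less_4 by linarith
  have "(2::real) ^ i \<le> 3 ^ i"
    by (intro power_mono) auto
  also have "\<dots> \<le> 2 * 4 ^ n"
  proof -
    have "3 ^ i * (1 / 4 ^ n) \<le> 3 ^ i * a"
      using a(1) by (intro mult_left_mono) auto
    then have "3 ^ i * (1 / 4 ^ n) \<le> (2::real)"
      using ia by linarith
    then show ?thesis by (simp add: field_simps)
  qed
  also have "\<dots> = 2 ^ (2 * n + 1)"
    by (simp add: power_mult)
  \<comment> \<open>Stage numbers start at 0, so \<open>2 * n + 2\<close> stages include stage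
    \<open>i\<close>.\<close>
  finally have "i \<le> 2 * n + 1"
    by (subst (asm) power_increasing_iff) auto
  \<comment> \<open>The query total is below \<open>3 * 3 ^ i / 2\<close>, and
    \<open>3 ^ i \<le> 2 / a\<close>; this is where the constant 3 comes from.\<close>
  moreover have "(3 ^ (i + 1) - 3 ^ 0) / 2 \<le> 3 / a"
    using ia a by (simp add: field_simps)
  ultimately show ?thesis
    using sin by (intro run_search_witness_within[of 0 i]) auto
qed

end

theorem proposition6:
  shows "\<exists>(c::real) (K::real). c > 0 \<and>
    (\<forall>(n::nat) (m::nat). m \<le> n \<longrightarrow>
      (\<exists>(s::nat) (A::qalg). valid_qalg n s A \<and>
        (\<forall>f\<in>cube n \<rightarrow> {1, -1}. \<forall>g\<in>cube n \<rightarrow> {1, -1}.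
          (uncorrelated n m f g \<longrightarrow>
             alg_prob n s f g A (\<lambda>v p q. v \<noteq> None) = 0) \<and>
          (\<not> uncorrelated n m f g \<longrightarrow>
             alg_prob n s f g A (\<lambda>v p q.
               (\<exists>u\<in>cube n. v = Some u \<and> wt u \<le> m \<and> cross_corr n f g u \<noteq> 0) \<and>
               ennreal (real p) \<le> ennreal K * (1 / ennreal (corr_amp n m f g)) \<and>
               ennreal (real q) \<le> ennreal K * (1 / ennreal (corr_amp n m f g))) \<ge> c))))"
proof (rule exI[of _ "1 / 4"], rule exI[of _ 3], intro conjI allI impI)
  fix n m :: nat
  let ?A = "search n m (2 * n + 2) 0"
  show "\<exists>s A. valid_qalg n s A \<and>
        (\<forall>f\<in>cube n \<rightarrow> {1, -1}. \<forall>g\<in>cube n \<rightarrow> {1, -1}.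
          (uncorrelated n m f g \<longrightarrow>
             alg_prob n s f g A (\<lambda>v p q. v \<noteq> None) = 0) \<and>
          (\<not> uncorrelated n m f g \<longrightarrow>
             alg_prob n s f g A (\<lambda>v p q.
               (\<exists>u\<in>cube n. v = Some u \<and> wt u \<le> m \<and> cross_corr n f g u \<noteq> 0) \<and>
               ennreal (real p) \<le> ennreal 3 * (1 / ennreal (corr_amp n m f g)) \<and>
               ennreal (real q) \<le> ennreal 3 * (1 / ennreal (corr_amp n m f g))) \<ge> 1 / 4))"
  proof (intro exI[of _ n] exI[of _ ?A] conjI ballI impI valid_search)
    fix f g :: "bool list \<Rightarrow> int"
    assume "f \<in> cube n \<rightarrow> {1, -1}" "g \<in> cube n \<rightarrow> {1, -1}"
    then interpret oracle_pair n m f g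
      by unfold_locales
    show "alg_prob n n f g ?A (\<lambda>v p q. v \<noteq> None) = 0" if "uncorrelated n m f g"
      using that by (rule run_search_uncorrelated)
    assume corr: "\<not> uncorrelated n m f g"
    \<comment> \<open>Positivity of \<open>a\<close> keeps \<open>1 / a\<close> finite, so the bound
      in \<open>ennreal\<close> becomes one between reals.\<close>
    have "0 < 1 / (4::real) ^ n" by simp
    then have a: "0 < corr_amp n m f g"
      using corr_amp_lower_bound[OF corr] by linarith
    then have "ennreal 3 * (1 / ennreal (corr_amp n m f g)) = ennreal (3 / corr_amp n m f g)"
      using divide_ennreal[of 1 "corr_amp n m f g"] ennreal_mult[of 3 "1 / corr_amp n m f g"]
      by simp
    then have "(\<lambda>v p q.
        (\<exists>u\<in>cube n. v = Some u \<and> wt u \<le> m \<and> cross_corr n f g u \<noteq> 0) \<and>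
        ennreal (real p) \<le> ennreal 3 * (1 / ennreal (corr_amp n m f g)) \<and>
        ennreal (real q) \<le> ennreal 3 * (1 / ennreal (corr_amp n m f g)))
        = witness_within (3 / corr_amp n m f g)"
      using a by (simp add: witness_within_def fun_eq_iff ennreal_le_iff)
    then show "alg_prob n n f g ?A (\<lambda>v p q.
        (\<exists>u\<in>cube n. v = Some u \<and> wt u \<le> m \<and> cross_corr n f g u \<noteq> 0) \<and>
        ennreal (real p) \<le> ennreal 3 * (1 / ennreal (corr_amp n m f g)) \<and>
        ennreal (real q) \<le> ennreal 3 * (1 / ennreal (corr_amp n m f g))) \<ge> 1 / 4"
      using run_search_correlated[OF corr] by simp
  qed
qed simp

end
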